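(* The following characterization of $H_{W,V}(\mathbb{T})$ holds: $$H_{W,V}(\mathbb{T})=\left\{f\in L^2_V(\mathbb{T}):\ f=\alpha_0+\sum_{i=1}^\infty\alpha_i\nu_i\ \text{ with }\ \sum_{i=1}^\infty\lambda_i\alpha_i^2<\infty\right\},$$ where $\alpha_0,\alpha_1,\alpha_2,\ldots\in\mathbb{R}$, the series for $f$ converges in $L^2_V(\mathbb{T})$, and $(\nu_i)_{i\ge0}$ is a complete orthonormal system of $L^2_V(\mathbb{T})$ of eigenvectors of $-\Delta_{W,V}$, $-\Delta_{W,V}\nu_i=\lambda_i\nu_i$, with $0=\lambda_0\le\lambda_1\le\lambda_2\le\cdots\to\infty$ and $\nu_0$ constant.
   Context: Notation. $\mathbb{T}=\mathbb{R}/\mathbb{Z}$; functions on $\mathbb{T}$ are identified with $1$-periodic functions on $\mathbb{R}$. Càdlàg means right-continuous with left limits; càglàd means left-continuous with right limits. $W,V:\mathbb{R}\to\mathbb{R}$ are strictly increasing, $W$ is càdlàg, $V$ is càglàd, and $W(x+1)-W(x)=W(1)-W(0)$, $V(x+1)-V(x)=V(1)-V(0)$ for all $x\in\mathbb{R}$; both are continuous at $0$ and $W(0)=V(0)=0$. No further continuity is assumed. $dW$ and $dV$ are the induced finite Borel measures on $\mathbb{T}$, with $dW((a,b])=W(b)-W(a)$ and $dV([a,b))=V(b)-V(a)$. $L^2_W(\mathbb{T})$, $L^2_V(\mathbb{T})$ are the corresponding (real) $L^2$ spaces; $\langle\cdot,\cdot\rangle_V$ is the inner product of $L^2_V(\mathbb{T})$;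 $L^2_{V,0}(\mathbb{T})=\{f\in L^2_V(\mathbb{T}):\int_{\mathbb{T}}f\,dV=0\}$. Lateral derivatives: $D^-_Wf(x)=\lim_{h\to0^-}\frac{f(x+h)-f(x)}{W(x+h)-W(x)}$ and $D^+_Vg(x)=\lim_{h\to0^+}\frac{g(x+h)-g(x)}{V(x+h)-V(x)}$; a function is $W$-left (resp. $V$-right) differentiable if the limit exists at every $x\in\mathbb{T}$. $\mathfrak{D}_{W,V}(\mathbb{T})$ is the set of càdlàg $f:\mathbb{T}\to\mathbb{R}$ that are $W$-left differentiable, with $D^-_Wf$ càglàd and $V$-right differentiable, and $D^+_VD^-_Wf$ càdlàg. $H_{W,V}(\mathbb{T})$: with the energetic norm $\|f\|_{1,2}^2=\langle(I-D^+_VD^-_W)f,f\rangle_V$ on $\mathfrak{D}_{W,V}(\mathbb{T})$, a function $f\in L^2_V(\mathbb{T})$ belongs to $H_{W,V}(\mathbb{T})$ iff there is a sequence $(f_n)$ in $\mathfrak{D}_{W,V}(\mathbb{T})$ with $f_n\to f$ in $L^2_V(\mathbb{T})$ and $(f_n)$ Cauchy with respect to $\|\cdot\|_{1,2}$. $\mathcal{A}:\mathcal{D}_{W,V}(\mathbb{T})\subseteq L^2_V(\mathbb{T})\to L^2_V(\mathbb{T})$ is the Friedrichs extension of $I-D^+_VD^-_W$ (initially defined on $\mathfrak{D}_{W,V}(\mathbb{T})$), and $\Delta_{W,V}:=I-\mathcal{A}$. Explicitly, $\mathcal{D}_{W,V}(\mathbb{T})$ is the set of $f\in L^2_V(\mathbb{T})$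 for which there are $a,b\in\mathbb{R}$ and $\mathfrak{f}\in L^2_{V,0}(\mathbb{T})$ with $$f(x)=a+bW(x)+\int_{(0,x]}\int_{[0,y)}\mathfrak{f}(s)\,dV(s)\,dW(y)\quad V\text{-a.e. } x\in[0,1),\qquad bW(1)+\int_{(0,1]}\int_{[0,y)}\mathfrak{f}(s)\,dV(s)\,dW(y)=0,$$ and then $\Delta_{W,V}f=\mathfrak{f}$. The resolvent of $\mathcal{A}$ is compact, so a system $(\nu_i,\lambda_i)_{i\ge0}$ as in the statement exists; the kernel of $\Delta_{W,V}$ consists of the constants. *)

theory Defs
  imports "HOL-Analysis.Analysis"
begin

definition cadlag :: "(real \<Rightarrow> real) \<Rightarrow> bool" where
  "cadlag f \<longleftrightarrow> (\<forall>x. (f \<longlongrightarrow> f x) (at_right x) \<and> (\<exists>l. (f \<longlongrightarrow> l) (at_left x)))"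

definition caglad :: "(real \<Rightarrow> real) \<Rightarrow> bool" where
  "caglad f \<longleftrightarrow> (\<forall>x. (f \<longlongrightarrow> f x) (at_left x) \<and> (\<exists>l. (f \<longlongrightarrow> l) (at_right x)))"

text \<open>Functions on the torus are 1-periodic functions on the real line.\<close>

definition periodic1 :: "(real \<Rightarrow> real) \<Rightarrow> bool" where
  "periodic1 f \<longleftrightarrow> (\<forall>x. f (x + 1) = f x)"

text \<open>
  Stieltjes measures on the whole line.  When \<open>W (x + 1) - W x\<close> and \<open>V (x + 1) - V x\<close> are
  constant, the measures on the torus are obtained by restricting to a fundamental domain
  \<open>{0..<1}\<close> or \<open>{0<..1}\<close>; the two choices agree when \<open>W\<close> and \<open>V\<close> are continuous at 0.
  The library's \<open>interval_measure\<close> needs a right-continuous function, so the measure of the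
  left-continuous \<open>V\<close> is the reflection of the measure of \<open>x \<mapsto> - V (- x)\<close>.
\<close>

definition dW :: "(real \<Rightarrow> real) \<Rightarrow> real measure" where
  "dW W = interval_measure W"

definition dV :: "(real \<Rightarrow> real) \<Rightarrow> real measure" where
  "dV V = distr (interval_measure (\<lambda>x. - V (- x))) borel uminus"

lemma emeasure_dW_Ioc:
  assumes "mono W" "cadlag W" "a \<le> b"
  shows "emeasure (dW W) {a<..b} = ennreal (W b - W a)"
  unfolding dW_def
  by (rule emeasure_interval_measure_Ioc)
     (use assms in \<open>auto simp: monoD cadlag_def continuous_within\<close>)

lemma emeasure_dV_Ico:
  assumes "mono V" "caglad V" "a \<le> b"
  shows "emeasure (dV V) {a..<b} = ennreal (V b - V a)"
proof -
  have rc: "continuous (at_right x) (\<lambda>x. - V (- x))" for x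
  proof -
    have "(V \<longlongrightarrow> V (- x)) (at_left (- x))"
      using assms(2) by (simp add: caglad_def)
    then have "((\<lambda>y. V (- y)) \<longlongrightarrow> V (- x)) (at_right x)"
      by (subst (asm) at_left_minus) (simp add: filterlim_filtermap)
    then show ?thesis
      by (auto simp: continuous_within intro: tendsto_minus)
  qed
  have "emeasure (dV V) {a..<b}
      = emeasure (interval_measure (\<lambda>x. - V (- x))) (uminus -` {a..<b})"
    unfolding dV_def by (subst emeasure_distr) simp_all
  also have "uminus -` {a..<b} = {- b<..- a}"
    by auto
  also have "emeasure (interval_measure (\<lambda>x. - V (- x))) {- b<..- a} = ennreal (V b - V a)"
    by (subst emeasure_interval_measure_Ioc) (use assms rc in \<open>auto simp: monoD\<close>)
  finally show ?thesis .
qed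

text \<open>
  The elements of the real \<open>L\<^sup>2\<close> spaces are represented by functions; two functions represent
  the same element iff they agree \<open>V\<close>-almost everywhere.
\<close>

definition L2 :: "(real \<Rightarrow> real) \<Rightarrow> (real \<Rightarrow> real) set" where
  "L2 V = {f \<in> borel_measurable borel.
             periodic1 f \<and> set_integrable (dV V) {0..<1} (\<lambda>x. (f x)\<^sup>2)}"

definition L2_zero_mean :: "(real \<Rightarrow> real) \<Rightarrow> (real \<Rightarrow> real) set" where
  "L2_zero_mean V = {f \<in> L2 V. (LINT x:{0..<1}|dV V. f x) = 0}"

definition inner_V :: "(real \<Rightarrow> real) \<Rightarrow> (real \<Rightarrow> real) \<Rightarrow> (real \<Rightarrow> real) \<Rightarrow> real" where
  "inner_V V f g = (LINT x:{0..<1}|dV V. f x * g x)"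

definition norm_V :: "(real \<Rightarrow> real) \<Rightarrow> (real \<Rightarrow> real) \<Rightarrow> real" where
  "norm_V V f = sqrt (inner_V V f f)"

definition L2_converges ::
  "(real \<Rightarrow> real) \<Rightarrow> (nat \<Rightarrow> real \<Rightarrow> real) \<Rightarrow> (real \<Rightarrow> real) \<Rightarrow> bool" where
  "L2_converges V F f \<longleftrightarrow> (\<lambda>n. norm_V V (\<lambda>x. F n x - f x)) \<longlonglongrightarrow> 0"

definition AE_torus :: "(real \<Rightarrow> real) \<Rightarrow> (real \<Rightarrow> bool) \<Rightarrow> bool" where
  "AE_torus V P \<longleftrightarrow> (AE x in dV V. x \<in> {0..<1} \<longrightarrow> P x)"

definition left_differentiable :: "(real \<Rightarrow> real) \<Rightarrow> (real \<Rightarrow> real) \<Rightarrow> bool" where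
  "left_differentiable W f \<longleftrightarrow>
     (\<forall>x. \<exists>l. ((\<lambda>h. (f (x + h) - f x) / (W (x + h) - W x)) \<longlongrightarrow> l) (at_left 0))"

definition left_deriv :: "(real \<Rightarrow> real) \<Rightarrow> (real \<Rightarrow> real) \<Rightarrow> real \<Rightarrow> real" where
  "left_deriv W f x = Lim (at_left 0) (\<lambda>h. (f (x + h) - f x) / (W (x + h) - W x))"

definition right_differentiable :: "(real \<Rightarrow> real) \<Rightarrow> (real \<Rightarrow> real) \<Rightarrow> bool" where
  "right_differentiable V g \<longleftrightarrow>
     (\<forall>x. \<exists>l. ((\<lambda>h. (g (x + h) - g x) / (V (x + h) - V x)) \<longlongrightarrow> l) (at_right 0))"

definition right_deriv :: "(real \<Rightarrow> real) \<Rightarrow> (real \<Rightarrow> real) \<Rightarrow> real \<Rightarrow> real" where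
  "right_deriv V g x = Lim (at_right 0) (\<lambda>h. (g (x + h) - g x) / (V (x + h) - V x))"

definition smooth_WV :: "(real \<Rightarrow> real) \<Rightarrow> (real \<Rightarrow> real) \<Rightarrow> (real \<Rightarrow> real) set" where
  "smooth_WV W V = {f. periodic1 f \<and> cadlag f \<and> left_differentiable W f \<and>
     caglad (left_deriv W f) \<and> right_differentiable V (left_deriv W f) \<and>
     cadlag (right_deriv V (left_deriv W f))}"

definition energy_norm ::
  "(real \<Rightarrow> real) \<Rightarrow> (real \<Rightarrow> real) \<Rightarrow> (real \<Rightarrow> real) \<Rightarrow> real" where
  "energy_norm W V f = sqrt (inner_V V (\<lambda>x. f x - right_deriv V (left_deriv W f) x) f)"

definition energy_Cauchy ::
  "(real \<Rightarrow> real) \<Rightarrow> (real \<Rightarrow> real) \<Rightarrow> (nat \<Rightarrow> real \<Rightarrow> real) \<Rightarrow> bool" where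
  "energy_Cauchy W V F \<longleftrightarrow>
     (\<forall>e>0. \<exists>N. \<forall>m\<ge>N. \<forall>n\<ge>N. energy_norm W V (\<lambda>x. F m x - F n x) < e)"

definition H_space :: "(real \<Rightarrow> real) \<Rightarrow> (real \<Rightarrow> real) \<Rightarrow> (real \<Rightarrow> real) set" where
  "H_space W V = {f \<in> L2 V. \<exists>F. (\<forall>n. F n \<in> smooth_WV W V) \<and>
     L2_converges V F f \<and> energy_Cauchy W V F}"

text \<open>
  The operator \<open>\<Delta> = I - A\<close>, with \<open>A\<close> the Friedrichs extension of \<open>I - D\<^sub>V D\<^sub>W\<close> on
  \<open>smooth_WV W V\<close>, in its explicit integral form: \<open>laplacian_rel W V f g\<close> says that \<open>f\<close> lies in
  the domain and that \<open>\<Delta> f\<close> is represented by \<open>g\<close>.  Since \<open>g\<close> is determined by \<open>f\<close> only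
  \<open>V\<close>-almost everywhere, \<open>laplacian W V f\<close> is an arbitrary representative and should only be
  compared with other functions almost everywhere.
\<close>

definition laplacian_rel ::
  "(real \<Rightarrow> real) \<Rightarrow> (real \<Rightarrow> real) \<Rightarrow> (real \<Rightarrow> real) \<Rightarrow> (real \<Rightarrow> real) \<Rightarrow> bool" where
  "laplacian_rel W V f g \<longleftrightarrow> f \<in> L2 V \<and> g \<in> L2_zero_mean V \<and>
     (\<exists>a b.
       AE_torus V (\<lambda>x. f x = a + b * W x
                     + (LINT y:{0<..x}|dW W. (LINT s:{0..<y}|dV V. g s))) \<and>
       b * W 1 + (LINT y:{0<..1}|dW W. (LINT s:{0..<y}|dV V. g s)) = 0)"

definition laplacian_domain :: "(real \<Rightarrow> real) \<Rightarrow> (real \<Rightarrow> real) \<Rightarrow> (real \<Rightarrow> real) set" where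
  "laplacian_domain W V = {f. \<exists>g. laplacian_rel W V f g}"

definition laplacian ::
  "(real \<Rightarrow> real) \<Rightarrow> (real \<Rightarrow> real) \<Rightarrow> (real \<Rightarrow> real) \<Rightarrow> real \<Rightarrow> real" where
  "laplacian W V f = (SOME g. laplacian_rel W V f g)"

text \<open>Completeness means that every element is the sum of its Fourier series.\<close>

definition complete_orthonormal :: "(real \<Rightarrow> real) \<Rightarrow> (nat \<Rightarrow> real \<Rightarrow> real) \<Rightarrow> bool" where
  "complete_orthonormal V \<nu> \<longleftrightarrow> (\<forall>i. \<nu> i \<in> L2 V) \<and>
     (\<forall>i j. inner_V V (\<nu> i) (\<nu> j) = (if i = j then 1 else 0)) \<and>
     (\<forall>f\<in>L2 V. L2_converges V (\<lambda>n x. \<Sum>i<n. inner_V V f (\<nu> i) * \<nu> i x) f)"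

end

theory Submission
  imports Defs
begin

text \<open>
  In the coordinates of the eigenbasis the energetic norm is a weighted \<open>\<ell>\<^sup>2\<close> norm: for smooth
  \<open>f\<close>,
  \<open>\<parallel>f\<parallel>\<^sup>2\<^sub>1\<^sub>2 = \<Sum>i. (1 + \<lambda>\<^sub>i) \<langle>f, \<nu>\<^sub>i\<rangle>\<^sup>2\<close> (\<open>energy_Parseval\<close>).
  This is Parseval's identity for \<open>\<langle>f - \<Delta>f, f\<rangle>\<close> together with
  \<open>\<langle>\<Delta>f, \<nu>\<^sub>i\<rangle> = - \<lambda>\<^sub>i \<langle>f, \<nu>\<^sub>i\<rangle>\<close>, which is the symmetry of the Laplacian.  Given the identity,
  one inclusion is lower semicontinuity: the coefficients of an energy-Cauchy sequence converge
  one by one, and finite partial sums of the weighted series stay bounded in the limit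
  (\<open>H_space_imp_summable\<close>).  For the other, the partial sums of the series are energy-Cauchy as
  soon as \<open>\<Sum>i. (1 + \<lambda>\<^sub>i) \<alpha>\<^sub>i\<^sup>2\<close> converges (\<open>series_imp_H_space\<close>), and
  \<open>\<lambda>\<^sub>i \<longlonglongrightarrow> \<infinity>\<close> reduces this to the convergence of \<open>\<Sum>i. \<lambda>\<^sub>i \<alpha>\<^sub>i\<^sup>2\<close>.

  Two facts about the operator carry this argument.

  First, lateral derivatives and Stieltjes integrals are inverse to each other, whatever the jumps
  of \<open>W\<close> and \<open>V\<close>.  A right-continuous function whose left \<open>W\<close>-derivative vanishes everywhere is
  constant (\<open>const_if_left_deriv_zero\<close>), and the integral of a left-continuous function over
  \<open>(0, x]\<close> has that function as its left \<open>W\<close>-derivative (\<open>prim_W_left_deriv\<close>).  Hence a smooth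
  function satisfies the integral form of the Laplacian (\<open>lateral_smooth_laplacian\<close>), to which
  Fubini's theorem applies and gives the symmetry (\<open>laplacian_symmetric\<close>).

  Second, the eigenvectors are smooth after modification on a null set
  (\<open>eigenfunction_smooth_representative\<close>), so that the partial sums of the series may serve as the
  approximating sequence.  This is a bootstrap: the integral formula for \<open>\<nu>\<^sub>i\<close> has a cadlag
  right-hand side, so \<open>\<Delta>\<nu>\<^sub>i = - \<lambda>\<^sub>i \<nu>\<^sub>i\<close> has a cadlag representative, and the double primitive of a
  cadlag function is smooth.

  The two weights play mirror-image roles.  Turning the graph of \<open>V\<close> about the origin yields a
  cadlag weight and exchanges right with left, so each fact about \<open>V\<close> is the mirrored fact for a
  weight like \<open>W\<close>.
\<close>

section \<open>Half-turns and one-sided regularity\<close>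

text \<open>
  The graph rotated by 180 degrees about the origin.  Unlike \<open>x \<mapsto> f (- x)\<close> it preserves
  monotonicity while exchanging left and right, so it carries left-continuous weights to
  right-continuous ones.
\<close>

definition halfturn :: "(real \<Rightarrow> real) \<Rightarrow> real \<Rightarrow> real" where
  "halfturn f x = - f (- x)"

lemma halfturn_halfturn [simp]: "halfturn (halfturn f) = f"
  by (auto simp: halfturn_def fun_eq_iff)

definition rcont :: "(real \<Rightarrow> real) \<Rightarrow> bool" where
  "rcont f \<longleftrightarrow> (\<forall>x. (f \<longlongrightarrow> f x) (at_right x))"

definition lcont :: "(real \<Rightarrow> real) \<Rightarrow> bool" where
  "lcont f \<longleftrightarrow> (\<forall>x. (f \<longlongrightarrow> f x) (at_left x))"

lemma tendsto_at_left_mirror: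
  fixes f :: "real \<Rightarrow> real"
  shows "((\<lambda>y. f (- y)) \<longlongrightarrow> l) (at_left (- x)) \<longleftrightarrow> (f \<longlongrightarrow> l) (at_right x)"
  by (subst at_right_minus) (simp add: filterlim_filtermap)

lemma tendsto_at_right_shift:
  fixes f :: "real \<Rightarrow> real"
  shows "((\<lambda>y. f (y + c)) \<longlongrightarrow> l) (at_right x) \<longleftrightarrow> (f \<longlongrightarrow> l) (at_right (x + c))"
  unfolding filterlim_at_right_to_0[of _ _ x] filterlim_at_right_to_0[of _ _ "x + c"]
  by (simp add: add.assoc)

lemma tendsto_at_left_shift:
  fixes f :: "real \<Rightarrow> real"
  shows "((\<lambda>y. f (y + c)) \<longlongrightarrow> l) (at_left x) \<longleftrightarrow> (f \<longlongrightarrow> l) (at_left (x + c))"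
  unfolding filterlim_at_left_to_right[of _ _ x] filterlim_at_left_to_right[of _ _ "x + c"]
    filterlim_at_right_to_0[of _ _ "- x"] filterlim_at_right_to_0[of _ _ "- (x + c)"]
  by (simp add: algebra_simps)

lemma lcont_mirror: "lcont (\<lambda>x. f (- x)) \<longleftrightarrow> rcont f"
proof -
  have "rcont f \<longleftrightarrow> (\<forall>x. (f \<longlongrightarrow> f (- x)) (at_right (- x)))"
    unfolding rcont_def by (metis minus_minus)
  then show ?thesis
    using tendsto_at_left_mirror[of f "f (- x)" "- x" for x] by (simp add: lcont_def)
qed

lemma rcont_mirror: "rcont (\<lambda>x. f (- x)) \<longleftrightarrow> lcont f"
  using lcont_mirror[of "\<lambda>x. f (- x)"] by simp

lemma halfturn_eq: "halfturn f = (\<lambda>x. - f (- x))"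
  by (simp add: halfturn_def fun_eq_iff)

lemma rcont_minus: "rcont (\<lambda>x. - f x) \<longleftrightarrow> rcont f"
  by (simp add: rcont_def tendsto_minus_cancel_left)

lemma rcont_halfturn: "rcont (halfturn f) \<longleftrightarrow> lcont f"
  unfolding halfturn_eq rcont_minus by (rule rcont_mirror)

lemma cadlag_halfturn: "cadlag (halfturn f) \<longleftrightarrow> caglad f"
proof -
  have "cadlag (halfturn f) \<longleftrightarrow> rcont (halfturn f) \<and> (\<forall>x. \<exists>l. (halfturn f \<longlongrightarrow> l) (at_left (- x)))"
    unfolding cadlag_def rcont_def by (metis minus_minus)
  also have "\<dots> \<longleftrightarrow> lcont f \<and> (\<forall>x. \<exists>l. ((\<lambda>y. - f y) \<longlongrightarrow> l) (at_right x))"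
    unfolding rcont_halfturn unfolding halfturn_eq using tendsto_at_left_mirror[of "\<lambda>y. - f y"] by simp
  also have "\<dots> \<longleftrightarrow> caglad f"
    unfolding caglad_def lcont_def using tendsto_minus[of f _ "at_right _"] tendsto_minus[of "\<lambda>y. - f y" _ "at_right _"] by fastforce
  finally show ?thesis .
qed

lemma cadlag_rcont: "cadlag f \<Longrightarrow> rcont f"
  by (simp add: cadlag_def rcont_def)

lemma caglad_lcont: "caglad f \<Longrightarrow> lcont f"
  by (simp add: caglad_def lcont_def)

text \<open>
  The function is the pointwise limit of the step functions that evaluate it at the next larger
  multiple of \<open>1 / (n + 1)\<close>; these sample points approach \<open>x\<close> strictly from the right.
\<close>

lemma rcont_measurable:
  assumes "rcont f"
  shows "f \<in> borel_measurable borel"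
proof (rule borel_measurable_LIMSEQ_metric)
  let ?s = "\<lambda>n x. (of_int \<lfloor>real (Suc n) * x\<rfloor> + 1) / real (Suc n)"
  show "(\<lambda>x. f (?s n x)) \<in> borel_measurable borel" for n
  proof -
    have "(\<lambda>x. \<lfloor>real (Suc n) * x\<rfloor>) \<in> measurable borel (count_space UNIV)"
      by measurable
    from measurable_compose[OF this, of "\<lambda>k. f ((of_int k + 1) / real (Suc n))" borel]
    show ?thesis by simp
  qed
  show "(\<lambda>n. f (?s n x)) \<longlonglongrightarrow> f x" for x
  proof (rule filterlim_compose[of f])
    show "(f \<longlongrightarrow> f x) (at_right x)"
      using assms by (simp add: rcont_def)
    have gt: "x < ?s n x" for n
    proof -
      have "real (Suc n) * x < of_int \<lfloor>real (Suc n) * x\<rfloor> + 1" by linarith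
      then show ?thesis by (simp add: field_simps del: of_nat_Suc)
    qed
    have le: "?s n x \<le> x + 1 / real (Suc n)" for n
    proof -
      have "of_int \<lfloor>real (Suc n) * x\<rfloor> \<le> real (Suc n) * x" by linarith
      then show ?thesis by (simp add: field_simps del: of_nat_Suc)
    qed
    have "(\<lambda>n. ?s n x) \<longlonglongrightarrow> x"
    proof (rule tendsto_sandwich)
      show "\<forall>\<^sub>F n in sequentially. x \<le> ?s n x" using gt by (intro always_eventually allI less_imp_le)
      show "\<forall>\<^sub>F n in sequentially. ?s n x \<le> x + 1 / real (Suc n)" using le by (intro always_eventually allI)
      have "(\<lambda>n. x + 1 / real (Suc n)) \<longlonglongrightarrow> x + 0"
        by (intro tendsto_intros LIMSEQ_Suc lim_1_over_n)
      then show "(\<lambda>n. x + 1 / real (Suc n)) \<longlonglongrightarrow> x" by simp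
    qed simp
    then show "filterlim (\<lambda>n. ?s n x) (at_right x) sequentially"
      unfolding filterlim_at using gt
      by (intro conjI always_eventually allI) (auto simp: less_imp_neq[OF gt, symmetric] simp del: of_nat_Suc)
  qed
qed

lemma lcont_measurable:
  assumes "lcont f"
  shows "f \<in> borel_measurable borel"
proof -
  have "(\<lambda>x. f (- x)) \<in> borel_measurable borel"
    using assms by (intro rcont_measurable) (simp add: rcont_mirror)
  from measurable_compose[OF borel_measurable_uminus[OF measurable_ident] this]
  show ?thesis by simp
qed

text \<open>
  One-sided limits bound the function near each point, and compactness makes the bound uniform.
\<close>

lemma regulated_bounded:
  fixes f :: "real \<Rightarrow> real"
  assumes "\<And>x. \<exists>l. (f \<longlongrightarrow> l) (at_left x)" and "\<And>x. \<exists>l. (f \<longlongrightarrow> l) (at_right x)"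
  shows "\<exists>C. \<forall>x\<in>{a..b}. \<bar>f x\<bar> \<le> C"
proof (rule ccontr)
  assume "\<not> ?thesis"
  then have "\<forall>n. \<exists>x. x \<in> {a..b} \<and> real n < \<bar>f x\<bar>" by (meson not_le)
  then obtain X where X: "\<And>n. X n \<in> {a..b}" "\<And>n. real n < \<bar>f (X n)\<bar>" by metis
  obtain c r where r: "strict_mono (r :: nat \<Rightarrow> nat)" "(X \<circ> r) \<longlonglongrightarrow> c"
    using compact_Icc[of a b] X(1) unfolding compact_def by metis
  have one_side: "\<exists>C. \<forall>\<^sub>F y in at c within S. \<bar>f y\<bar> \<le> C" if lim: "(f \<longlongrightarrow> l) (at c within S)" for S l
  proof -
    have "\<forall>\<^sub>F y in at c within S. dist (f y) l < 1"
      using lim by (simp add: tendsto_iff)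
    then have "\<forall>\<^sub>F y in at c within S. \<bar>f y\<bar> \<le> \<bar>l\<bar> + 1"
      by eventually_elim (auto simp: dist_real_def)
    then show ?thesis by blast
  qed
  obtain C1 C2 where "\<forall>\<^sub>F y in at_left c. \<bar>f y\<bar> \<le> C1" "\<forall>\<^sub>F y in at_right c. \<bar>f y\<bar> \<le> C2"
    using one_side assms by meson
  then have "\<forall>\<^sub>F y in at_left c. \<bar>f y\<bar> \<le> max (max C1 C2) \<bar>f c\<bar>"
    "\<forall>\<^sub>F y in at_right c. \<bar>f y\<bar> \<le> max (max C1 C2) \<bar>f c\<bar>"
    by (auto elim!: eventually_mono)
  then have "\<forall>\<^sub>F y in nhds c. \<bar>f y\<bar> \<le> max (max C1 C2) \<bar>f c\<bar>"
    by (auto simp: eventually_nhds_conv_at eventually_at_split)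
  then have ev: "\<forall>\<^sub>F n in sequentially. \<bar>f (X (r n))\<bar> \<le> max (max C1 C2) \<bar>f c\<bar>"
    using r(2) by (auto simp: filterlim_iff)
  obtain N where N: "max (max C1 C2) \<bar>f c\<bar> \<le> real N" using real_arch_simple by blast
  obtain n where n: "n \<ge> N" "\<bar>f (X (r n))\<bar> \<le> max (max C1 C2) \<bar>f c\<bar>"
    using ev unfolding eventually_sequentially by (metis nat_le_linear)
  have "real N \<le> real (r n)" using n(1) seq_suble[OF r(1), of n] by simp
  with N n(2) X(2)[of "r n"] show False by linarith
qed

lemma cadlag_bounded: "cadlag f \<Longrightarrow> \<exists>C. \<forall>x\<in>{a..b}. \<bar>f x\<bar> \<le> C"
  by (rule regulated_bounded) (auto simp: cadlag_def)

lemma caglad_bounded: "caglad f \<Longrightarrow> \<exists>C. \<forall>x\<in>{a..b}. \<bar>f x\<bar> \<le> C"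
  by (rule regulated_bounded) (auto simp: caglad_def)

lemma rcont_add: "rcont f \<Longrightarrow> rcont g \<Longrightarrow> rcont (\<lambda>x. f x + g x)"
  by (simp add: rcont_def tendsto_add)

lemma rcont_cmult: "rcont f \<Longrightarrow> rcont (\<lambda>x. c * f x)"
  by (simp add: rcont_def tendsto_mult_left)

lemma lcont_add: "lcont f \<Longrightarrow> lcont g \<Longrightarrow> lcont (\<lambda>x. f x + g x)"
  by (simp add: lcont_def tendsto_add)

lemma lcont_cmult: "lcont f \<Longrightarrow> lcont (\<lambda>x. c * f x)"
  by (simp add: lcont_def tendsto_mult_left)

lemma cadlag_add: "cadlag f \<Longrightarrow> cadlag g \<Longrightarrow> cadlag (\<lambda>x. f x + g x)"
  unfolding cadlag_def by (blast intro: tendsto_add)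

lemma cadlag_cmult: "cadlag f \<Longrightarrow> cadlag (\<lambda>x. c * f x)"
  unfolding cadlag_def by (blast intro: tendsto_mult_left)

text \<open>
  The extension may jump at the integers, but a left limit there is a left limit of \<open>P\<close> at 1, so
  the values of \<open>P\<close> at 0 and 1 need not match.
\<close>

lemma cadlag_periodic_extension:
  assumes "cadlag P"
  shows "cadlag (\<lambda>x. P (frac x))"
  unfolding cadlag_def
proof
  fix x :: real
  have shift_r: "((\<lambda>y. P (y - c)) \<longlongrightarrow> P (x - c)) (at_right x)" for c
    using assms tendsto_at_right_shift[of P "- c" _ x] by (simp add: cadlag_def)
  have "\<forall>\<^sub>F y in at_right x. P (y - \<lfloor>x\<rfloor>) = P (frac y)"
    unfolding eventually_at_right_field
  proof (intro exI[of _ "of_int \<lfloor>x\<rfloor> + 1"] conjI allI impI)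
    fix y assume "x < y" "y < of_int \<lfloor>x\<rfloor> + 1"
    then have "\<lfloor>y\<rfloor> = \<lfloor>x\<rfloor>" by linarith
    then show "P (y - \<lfloor>x\<rfloor>) = P (frac y)" by (simp add: frac_def)
  qed linarith
  from Lim_transform_eventually[OF shift_r this]
  have right: "((\<lambda>x. P (frac x)) \<longlongrightarrow> P (frac x)) (at_right x)" by (simp add: frac_def)
  \<comment> \<open>Immediately to the left of \<open>x\<close> the integer part is \<open>\<lceil>x\<rceil> - 1\<close>, also when \<open>x\<close> is an integer.\<close>
  define c where "c = real_of_int (\<lceil>x\<rceil> - 1)"
  obtain l where "(P \<longlongrightarrow> l) (at_left (x - c))" using assms by (auto simp: cadlag_def)
  then have "((\<lambda>y. P (y - c)) \<longlongrightarrow> l) (at_left x)"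
    using tendsto_at_left_shift[of P "- c" l x] by simp
  moreover have "\<forall>\<^sub>F y in at_left x. P (y - c) = P (frac y)"
    unfolding eventually_at_left_field
  proof (intro exI[of _ c] conjI allI impI)
    show "c < x" unfolding c_def by linarith
    fix y assume "c < y" "y < x"
    then have "\<lfloor>y\<rfloor> = \<lceil>x\<rceil> - 1" unfolding c_def by linarith
    then have "real_of_int \<lfloor>y\<rfloor> = c" by (simp add: c_def)
    then show "P (y - c) = P (frac y)" by (simp add: frac_def)
  qed
  ultimately have "((\<lambda>x. P (frac x)) \<longlongrightarrow> l) (at_left x)" by (rule Lim_transform_eventually)
  with right show "((\<lambda>x. P (frac x)) \<longlongrightarrow> P (frac x)) (at_right x) \<and> (\<exists>l. ((\<lambda>x. P (frac x)) \<longlongrightarrow> l) (at_left x))"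
    by blast
qed

section \<open>Derivatives with respect to a weight\<close>

definition has_left_deriv :: "(real \<Rightarrow> real) \<Rightarrow> (real \<Rightarrow> real) \<Rightarrow> real \<Rightarrow> real \<Rightarrow> bool" where
  "has_left_deriv W f x l \<longleftrightarrow> ((\<lambda>h. (f (x + h) - f x) / (W (x + h) - W x)) \<longlongrightarrow> l) (at_left 0)"

definition has_right_deriv :: "(real \<Rightarrow> real) \<Rightarrow> (real \<Rightarrow> real) \<Rightarrow> real \<Rightarrow> real \<Rightarrow> bool" where
  "has_right_deriv V g x l \<longleftrightarrow> ((\<lambda>h. (g (x + h) - g x) / (V (x + h) - V x)) \<longlongrightarrow> l) (at_right 0)"

lemma has_left_deriv_at_left:
  "has_left_deriv W f x l \<longleftrightarrow> ((\<lambda>y. (f y - f x) / (W y - W x)) \<longlongrightarrow> l) (at_left x)"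
  using tendsto_at_left_shift[of "\<lambda>y. (f y - f x) / (W y - W x)" x l 0]
  by (simp add: has_left_deriv_def add.commute)

lemma has_right_deriv_halfturn:
  "has_right_deriv V g x l \<longleftrightarrow> has_left_deriv (halfturn V) (halfturn g) (- x) l"
proof -
  have "(- g (x - h) + g x) / (- V (x - h) + V x) = (g (x - h) - g x) / (V (x - h) - V x)" for h
    using minus_divide_divide[of "g (x - h) - g x" "V (x - h) - V x"] by simp
  then show ?thesis
    using tendsto_at_left_mirror[of "\<lambda>h. (g (x + h) - g x) / (V (x + h) - V x)" l 0]
    by (simp add: has_left_deriv_def has_right_deriv_def halfturn_def)
qed

lemma left_deriv_eq: "has_left_deriv W f x l \<Longrightarrow> left_deriv W f x = l"
  unfolding left_deriv_def has_left_deriv_def by (rule tendsto_Lim) simp_all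

lemma right_deriv_eq: "has_right_deriv V f x l \<Longrightarrow> right_deriv V f x = l"
  unfolding right_deriv_def has_right_deriv_def by (rule tendsto_Lim) simp_all

lemma has_left_deriv_add:
  "has_left_deriv W f x l \<Longrightarrow> has_left_deriv W g x m \<Longrightarrow> has_left_deriv W (\<lambda>x. f x + g x) x (l + m)"
  unfolding has_left_deriv_def
  by (drule (1) tendsto_add) (simp add: add_diff_add add_divide_distrib)

lemma has_left_deriv_cmult:
  "has_left_deriv W f x l \<Longrightarrow> has_left_deriv W (\<lambda>x. c * f x) x (c * l)"
  unfolding has_left_deriv_def
  by (drule tendsto_mult_left[of _ _ _ c]) (simp add: right_diff_distrib)

lemma has_right_deriv_add:
  "has_right_deriv W f x l \<Longrightarrow> has_right_deriv W g x m \<Longrightarrow> has_right_deriv W (\<lambda>x. f x + g x) x (l + m)"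
  unfolding has_right_deriv_def
  by (drule (1) tendsto_add) (simp add: add_diff_add add_divide_distrib)

lemma has_right_deriv_cmult:
  "has_right_deriv W f x l \<Longrightarrow> has_right_deriv W (\<lambda>x. c * f x) x (c * l)"
  unfolding has_right_deriv_def
  by (drule tendsto_mult_left[of _ _ _ c]) (simp add: right_diff_distrib)

lemma has_left_deriv_const: "has_left_deriv W (\<lambda>x. c) x 0"
  by (simp add: has_left_deriv_def)

lemma has_right_deriv_const: "has_right_deriv W (\<lambda>x. c) x 0"
  by (simp add: has_right_deriv_def)

lemma has_left_deriv_shift:
  assumes "\<And>x. W (x + 1) - W x = W 1 - W (0::real)" "has_left_deriv W f (x + 1) l"
  shows "has_left_deriv W (\<lambda>x. f (x + 1)) x l"
proof -
  have "W (x + 1 + h) - W (x + 1) = W (x + h) - W x" for h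
    using assms(1)[of "x + h"] assms(1)[of x] by (simp add: algebra_simps)
  then show ?thesis
    using assms(2) unfolding has_left_deriv_def by (simp add: add.commute add.left_commute)
qed

lemma has_right_deriv_shift:
  assumes "\<And>x. W (x + 1) - W x = W 1 - W (0::real)" "has_right_deriv W f (x + 1) l"
  shows "has_right_deriv W (\<lambda>x. f (x + 1)) x l"
proof -
  have "W (x + 1 + h) - W (x + 1) = W (x + h) - W x" for h
    using assms(1)[of "x + h"] assms(1)[of x] by (simp add: algebra_simps)
  then show ?thesis
    using assms(2) unfolding has_right_deriv_def by (simp add: add.commute add.left_commute)
qed

text \<open>
  The mean value estimate \<open>\<bar>E b - E x\<bar> \<le> e * (W b - W x)\<close> is propagated from \<open>x = b\<close> to the left.  Right
  continuity carries it to the infimum \<open>s\<close> of the points reached, and the vanishing left derivative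
  at \<open>s\<close> carries it beyond \<open>s\<close>; so \<open>s\<close> is the left end point.  Jumps of \<open>W\<close> do no harm, because
  neither step needs continuity from the left.
\<close>

lemma const_if_left_deriv_zero:
  assumes "strict_mono W" "rcont W" "rcont E" and der: "\<And>x. has_left_deriv W E x 0"
  shows "E x = E y"
proof -
  have step: "\<forall>\<^sub>F y in at_left x. \<bar>E x - E y\<bar> \<le> e * (W x - W y)" if "e > 0" for x e
  proof -
    have "\<forall>\<^sub>F y in at_left x. dist ((E y - E x) / (W y - W x)) 0 < e"
      using der[of x] that unfolding has_left_deriv_at_left tendsto_iff by blast
    moreover have "\<forall>\<^sub>F y in at_left x. y < x" by (simp add: eventually_at_filter)
    ultimately show ?thesis
    proof eventually_elim
      case (elim y)
      then have "W y < W x" using assms(1) by (simp add: strict_mono_def)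
      with elim show ?case
        by (simp add: dist_real_def abs_divide field_simps abs_minus_commute)
    qed
  qed
  have est: "\<bar>E b - E a\<bar> \<le> e * (W b - W a)" if "a \<le> b" "e > 0" for a b e
  proof -
    define P where "P x \<longleftrightarrow> \<bar>E b - E x\<bar> \<le> e * (W b - W x)" for x
    define S where "S = {x \<in> {a..b}. \<forall>y\<in>{x..b}. P y}"
    define s where "s = Inf S"
    have bS: "b \<in> S" using that by (auto simp: S_def P_def)
    have bdd: "bdd_below S" by (rule bdd_belowI[of _ a]) (auto simp: S_def)
    have sa: "a \<le> s" "s \<le> b"
      unfolding s_def using bS bdd by (auto intro!: cInf_greatest cInf_lower simp: S_def)
    have above: "P y" if y: "s < y" "y \<le> b" for y
    proof -
      obtain x where "x \<in> S" "x < y" using y(1) cInf_less_iff[OF _ bdd, of y] bS unfolding s_def by auto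
      then show ?thesis using y(2) by (auto simp: S_def)
    qed
    have Ps: "P s"
    proof (cases "s = b")
      case True then show ?thesis by (simp add: P_def)
    next
      case False
      with sa have "s < b" by simp
      have "((\<lambda>x. \<bar>E b - E x\<bar>) \<longlongrightarrow> \<bar>E b - E s\<bar>) (at_right s)"
        "((\<lambda>x. e * (W b - W x)) \<longlongrightarrow> e * (W b - W s)) (at_right s)"
        using assms(2,3) by (auto simp: rcont_def intro!: tendsto_intros)
      moreover have "\<forall>\<^sub>F y in at_right s. \<bar>E b - E y\<bar> \<le> e * (W b - W y)"
        unfolding P_def[symmetric] eventually_at_right_field using above \<open>s < b\<close> by (auto intro!: exI[of _ b])
      ultimately show ?thesis
        unfolding P_def by (intro tendsto_le[of "at_right s" _ _ "\<lambda>x. \<bar>E b - E x\<bar>"]) auto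
    qed
    have "s = a"
    proof (rule ccontr)
      assume "s \<noteq> a"
      with sa have "a < s" by simp
      obtain d where d: "d < s" "\<And>y. d < y \<Longrightarrow> y < s \<Longrightarrow> \<bar>E s - E y\<bar> \<le> e * (W s - W y)"
        using step[OF \<open>e > 0\<close>, of s] \<open>a < s\<close> unfolding eventually_at_left_field by blast
      define t where "t = max a ((d + s) / 2)"
      have t: "a \<le> t" "t < s" "d < t" using d \<open>a < s\<close> by (auto simp: t_def less_max_iff_disj)
      have "P y" if y: "t \<le> y" "y < s" for y
      proof -
        have "\<bar>E s - E y\<bar> \<le> e * (W s - W y)" using d(2)[of y] y t by auto
        with Ps show ?thesis unfolding P_def by (simp add: algebra_simps)
      qed
      then have "P y" if "t \<le> y" "y \<le> b" for y
        using Ps above that by (cases y s rule: linorder_cases) auto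
      then have "t \<in> S" using t sa by (simp add: S_def)
      then have "s \<le> t" unfolding s_def by (rule cInf_lower[OF _ bdd])
      with t show False by simp
    qed
    with Ps show ?thesis by (simp add: P_def)
  qed
  have "E b = E a" if "a \<le> b" for a b
  proof -
    have "\<bar>E b - E a\<bar> \<le> 0"
    proof (rule field_le_epsilon)
      fix d :: real assume "d > 0"
      have "W a \<le> W b" using assms(1) that by (simp add: strict_mono_less_eq)
      have "\<bar>E b - E a\<bar> \<le> d / (W b - W a + 1) * (W b - W a)"
        using est[OF that, of "d / (W b - W a + 1)"] \<open>d > 0\<close> \<open>W a \<le> W b\<close> by simp
      also have "\<dots> \<le> 0 + d" using \<open>d > 0\<close> \<open>W a \<le> W b\<close> by (simp add: field_simps)
      finally show "\<bar>E b - E a\<bar> \<le> 0 + d" .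
    qed
    then show ?thesis by simp
  qed
  then show ?thesis by (metis linear)
qed

lemma left_deriv_unique:
  assumes "strict_mono W" "rcont W" "rcont E" "rcont F"
    and "\<And>x. has_left_deriv W E x (G x)" "\<And>x. has_left_deriv W F x (G x)"
  shows "E x - E y = F x - F y"
proof -
  have "has_left_deriv W (\<lambda>x. E x + (- 1) * F x) x 0" for x
    using has_left_deriv_add[OF assms(5)[of x] has_left_deriv_cmult[OF assms(6)[of x], of "- 1"]] by simp
  moreover have "rcont (\<lambda>x. E x + (- 1) * F x)"
    using assms(3,4) by (intro rcont_add rcont_cmult)
  ultimately have "E x + (- 1) * F x = E y + (- 1) * F y"
    by (intro const_if_left_deriv_zero[OF assms(1,2)])
  then show ?thesis by simp
qed

text \<open>
  The half-turn of \<open>left_deriv_unique\<close>.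
\<close>

lemma right_deriv_unique:
  assumes "strict_mono V" "lcont V" "lcont E" "lcont F"
    and "\<And>x. has_right_deriv V E x (G x)" "\<And>x. has_right_deriv V F x (G x)"
  shows "E x - E y = F x - F y"
proof -
  have "strict_mono (halfturn V)" using assms(1) by (simp add: strict_mono_def halfturn_def)
  moreover have "has_left_deriv (halfturn V) (halfturn E) x (G (- x))" 
    "has_left_deriv (halfturn V) (halfturn F) x (G (- x))" for x
    using assms(5,6)[of "- x"] by (simp_all add: has_right_deriv_halfturn)
  ultimately have "halfturn E (- x) - halfturn E (- y) = halfturn F (- x) - halfturn F (- y)"
    using assms(2-4) by (intro left_deriv_unique[of "halfturn V" _ _ "\<lambda>x. G (- x)"]) (auto simp: rcont_halfturn)
  then show ?thesis by (simp add: halfturn_def)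
qed

section \<open>Primitives and the fundamental theorem of calculus\<close>

lemma sets_dW [simp, measurable_cong]: "sets (dW W) = sets borel"
  by (simp add: dW_def)

lemma space_dW [simp]: "space (dW W) = UNIV"
  by (simp add: dW_def)

lemma sets_dV [simp, measurable_cong]: "sets (dV V) = sets borel"
  by (simp add: dV_def)

lemma space_dV [simp]: "space (dV V) = UNIV"
  by (simp add: dV_def)

definition loc_int_W :: "(real \<Rightarrow> real) \<Rightarrow> (real \<Rightarrow> real) \<Rightarrow> bool" where
  "loc_int_W W h \<longleftrightarrow> (\<forall>a b. set_integrable (dW W) {a<..b} h)"

text \<open>
  The integral from 0 with the orientation of the interval taken into account, so that differences of
  values are integrals over half-open intervals on the whole line (\<open>prim_W_diff\<close>).
\<close>

definition prim_W :: "(real \<Rightarrow> real) \<Rightarrow> (real \<Rightarrow> real) \<Rightarrow> real \<Rightarrow> real" where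
  "prim_W W h x = (if 0 \<le> x then LINT t:{0<..x}|dW W. h t else - (LINT t:{x<..0}|dW W. h t))"

lemma prim_W_0 [simp]: "prim_W W h 0 = 0"
  by (simp add: prim_W_def set_lebesgue_integral_def)

lemma prim_W_diff:
  assumes "loc_int_W W h" "x \<le> y"
  shows "prim_W W h y - prim_W W h x = (LINT t:{x<..y}|dW W. h t)"
proof -
  have add: "(LINT t:{a<..c}|dW W. h t) = (LINT t:{a<..b}|dW W. h t) + (LINT t:{b<..c}|dW W. h t)"
    if "a \<le> b" "b \<le> c" for a b c
  proof -
    have "{a<..c} = {a<..b} \<union> {b<..c}" using that by auto
    then show ?thesis
      using assms(1) by (simp add: loc_int_W_def set_integral_Un)
  qed
  show ?thesis
    using assms(2) add[of 0 x y] add[of x 0 y] add[of x y 0] by (auto simp: prim_W_def)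
qed

lemma prim_W_rcont:
  assumes "loc_int_W W h"
  shows "rcont (prim_W W h)"
  unfolding rcont_def
proof
  fix x :: real
  show "(prim_W W h \<longlongrightarrow> prim_W W h x) (at_right x)"
  proof (rule tendsto_at_right_sequentially[where b = "x + 1"])
    fix S :: "nat \<Rightarrow> real"
    assume S: "\<And>n. x < S n" "decseq S" "S \<longlonglongrightarrow> x"
    have "(\<lambda>n. LINT t:{x<..S n}|dW W. h t) \<longlonglongrightarrow> (LINT t:(\<Inter>n. {x<..S n})|dW W. h t)"
      using assms S by (intro set_integral_cont_down) (auto simp: loc_int_W_def decseq_def, meson order_trans)
    moreover have "(\<Inter>n. {x<..S n}) = {}"
    proof safe
      fix t assume "t \<in> (\<Inter>n. {x<..S n})"
      then have t: "x < t" "\<And>n. t \<le> S n" by auto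
      have "\<forall>\<^sub>F n in sequentially. S n < t" using order_tendstoD(2)[OF S(3) t(1)] .
      with t(2) show "t \<in> {}" by (auto simp: eventually_sequentially not_less[symmetric])
    qed
    ultimately have "(\<lambda>n. prim_W W h (S n) - prim_W W h x) \<longlonglongrightarrow> 0"
      using prim_W_diff[OF assms less_imp_le[OF S(1)]] by (simp add: set_lebesgue_integral_def)
    then show "(\<lambda>n. prim_W W h (S n)) \<longlonglongrightarrow> prim_W W h x"
      by (rule LIM_zero_cancel)
  qed simp
qed

locale weight =
  fixes W :: "real \<Rightarrow> real"
  assumes smono: "strict_mono W" and cadl: "cadlag W"
begin

lemma rcont_weight: "rcont W"
  using cadl by (rule cadlag_rcont)

lemma emeasure_Ioc: "a \<le> b \<Longrightarrow> emeasure (dW W) {a<..b} = ennreal (W b - W a)"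
  by (rule emeasure_dW_Ioc[OF strict_mono_mono[OF smono] cadl])

lemma measure_Ioc: "a \<le> b \<Longrightarrow> measure (dW W) {a<..b} = W b - W a"
  using emeasure_Ioc[of a b] smono by (simp add: measure_def strict_mono_less_eq)

lemma finite_Ioc: "emeasure (dW W) {a<..b} < \<infinity>"
  using emeasure_Ioc[of a b] by (cases "a \<le> b") auto

lemma sigma_finite_dW: "sigma_finite_measure (dW W)"
  unfolding dW_def using smono cadl
  by (intro sigma_finite_interval_measure)
     (auto simp: strict_mono_less_eq cadlag_def continuous_within)

lemma loc_int_bounded:
  assumes "h \<in> borel_measurable borel" "\<And>a b. \<exists>C. \<forall>x\<in>{a..b}. \<bar>h x\<bar> \<le> C"
  shows "loc_int_W W h"
  unfolding loc_int_W_def set_integrable_def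
proof safe
  fix a b :: real
  obtain C where "\<forall>x\<in>{a..b}. \<bar>h x\<bar> \<le> C" using assms(2) by blast
  then show "integrable (dW W) (\<lambda>x. indicat_real {a<..b} x *\<^sub>R h x)"
    using finite_Ioc[of a b] assms(1)
    by (intro integrableI_bounded_set_indicator[where B = C]) (auto intro!: AE_I2)
qed

text \<open>
  The difference quotient is the \<open>dW\<close>-mean of \<open>h\<close> over \<open>(y, x]\<close>.  This interval contains \<open>x\<close> itself, so
  an atom of \<open>dW\<close> at \<open>x\<close> contributes the right value \<open>h x\<close>, and left continuity controls the rest.
\<close>

lemma prim_W_left_deriv:
  assumes "loc_int_W W h" "(h \<longlongrightarrow> h x) (at_left x)"
  shows "has_left_deriv W (prim_W W h) x (h x)"
  unfolding has_left_deriv_at_left tendsto_iff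
proof safe
  fix e :: real assume "e > 0"
  then have "\<forall>\<^sub>F y in at_left x. dist (h y) (h x) < e / 2"
    using assms(2) unfolding tendsto_iff by (meson half_gt_zero)
  then obtain d where d: "d < x" "\<And>y. d < y \<Longrightarrow> y < x \<Longrightarrow> \<bar>h y - h x\<bar> < e / 2"
    unfolding eventually_at_left_field dist_real_def by blast
  show "\<forall>\<^sub>F y in at_left x. dist ((prim_W W h y - prim_W W h x) / (W y - W x)) (h x) < e"
    unfolding eventually_at_left_field
  proof (intro exI conjI allI impI)
    show "d < x" by fact
    fix y assume y: "d < y" "y < x"
    have near: "h t \<le> h x + e / 2" "h x - e / 2 \<le> h t" if "t \<in> {y<..x}" for t
    proof -
      have "\<bar>h t - h x\<bar> \<le> e / 2"
      proof (cases "t = x")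
        case False
        then show ?thesis using d(2)[of t] y that by simp
      qed (use \<open>e > 0\<close> in simp)
      then show "h t \<le> h x + e / 2" "h x - e / 2 \<le> h t" by linarith+
    qed
    have Wyx: "W y < W x" using smono y by (simp add: strict_mono_def)
    have const: "set_integrable (dW W) {y<..x} (\<lambda>_. c)" "(LINT t:{y<..x}|dW W. c) = c * (W x - W y)" for c :: real
      using finite_Ioc[of y x] measure_Ioc[of y x] y
      by (auto simp: set_integrable_def set_integral_const)
    have int: "set_integrable (dW W) {y<..x} h" using assms(1) by (simp add: loc_int_W_def)
    have "(LINT t:{y<..x}|dW W. h t) \<le> (LINT t:{y<..x}|dW W. h x + e / 2)"
      by (rule set_integral_mono[OF int const(1)]) (use near in blast)
    moreover have "(LINT t:{y<..x}|dW W. h x - e / 2) \<le> (LINT t:{y<..x}|dW W. h t)"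
      by (rule set_integral_mono[OF const(1) int]) (use near in blast)
    ultimately have "\<bar>(LINT t:{y<..x}|dW W. h t) - h x * (W x - W y)\<bar> \<le> e / 2 * (W x - W y)"
      unfolding const distrib_right left_diff_distrib by linarith
    then have "\<bar>(LINT t:{y<..x}|dW W. h t) / (W x - W y) - h x\<bar> \<le> e / 2"
      using Wyx by (simp add: field_simps abs_le_iff)
    moreover have "(prim_W W h y - prim_W W h x) / (W y - W x) = (LINT t:{y<..x}|dW W. h t) / (W x - W y)"
      using prim_W_diff[OF assms(1), of y x] y Wyx by (simp add: field_simps)
    ultimately show "dist ((prim_W W h y - prim_W W h x) / (W y - W x)) (h x) < e"
      using \<open>e > 0\<close> by (simp add: dist_real_def)
  qed
qed

text \<open>
  The increment of \<open>f\<close> is the difference quotient times the increment of \<open>W\<close>, and \<open>W\<close> has left limits.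
\<close>

lemma left_deriv_imp_left_limit:
  assumes "has_left_deriv W f x l"
  shows "\<exists>m. (f \<longlongrightarrow> m) (at_left x)"
proof -
  obtain w where w: "(W \<longlongrightarrow> w) (at_left x)" using cadl by (auto simp: cadlag_def)
  have "((\<lambda>y. f x + (f y - f x) / (W y - W x) * (W y - W x)) \<longlongrightarrow> f x + l * (w - W x)) (at_left x)"
    using assms w unfolding has_left_deriv_at_left by (intro tendsto_intros)
  moreover have "\<forall>\<^sub>F y in at_left x. f x + (f y - f x) / (W y - W x) * (W y - W x) = f y"
    unfolding eventually_at_filter
    using smono by (auto intro!: always_eventually simp: strict_mono_eq)
  ultimately have "(f \<longlongrightarrow> f x + l * (w - W x)) (at_left x)"
    by (rule Lim_transform_eventually)
  then show ?thesis by blast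
qed

lemma cadlag_if_left_deriv:
  assumes "rcont f" "\<And>x. has_left_deriv W f x (G x)"
  shows "cadlag f"
  using assms left_deriv_imp_left_limit[OF assms(2)] by (auto simp: cadlag_def rcont_def)

lemma fundamental_theorem_W:
  assumes "rcont f" "\<And>x. has_left_deriv W f x (G x)" "lcont G" "loc_int_W W G"
  shows "f x = f 0 + prim_W W G x"
proof -
  have "f x - f 0 = prim_W W G x - prim_W W G 0"
    using assms by (intro left_deriv_unique[OF smono rcont_weight _ prim_W_rcont _ prim_W_left_deriv])
      (auto simp: lcont_def)
  then show ?thesis by simp
qed

end

definition loc_int_V :: "(real \<Rightarrow> real) \<Rightarrow> (real \<Rightarrow> real) \<Rightarrow> bool" where
  "loc_int_V V g \<longleftrightarrow> (\<forall>a b. set_integrable (dV V) {a..<b} g)"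

text \<open>
  The oriented integral of \<open>g\<close> over \<open>[0, y)\<close> with respect to \<open>dV\<close> (\<open>prim_V_diff\<close>), written as a
  half-turn so that its properties are inherited from \<open>prim_W\<close>.
\<close>

definition prim_V :: "(real \<Rightarrow> real) \<Rightarrow> (real \<Rightarrow> real) \<Rightarrow> real \<Rightarrow> real" where
  "prim_V V g = halfturn (prim_W (halfturn V) (\<lambda>s. g (- s)))"

lemma dV_eq_distr: "dV V = distr (dW (halfturn V)) borel uminus"
  by (simp add: dV_def dW_def halfturn_eq)

lemma indicator_Ico_uminus: "indicator {a..<b} (- t) = (indicator {- b<..- a} t :: real)" for t :: real
  by (auto simp: indicator_def)

lemma set_integrable_dV:
  fixes g :: "real \<Rightarrow> real"
  assumes "g \<in> borel_measurable borel"
  shows "set_integrable (dV V) {a..<b} g \<longleftrightarrow> set_integrable (dW (halfturn V)) {- b<..- a} (\<lambda>s. g (- s))"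
  unfolding set_integrable_def dV_eq_distr
  using integrable_distr_eq[of uminus "dW (halfturn V)" borel "\<lambda>s. indicator {a..<b} s *\<^sub>R g s"] assms
  by (simp add: indicator_Ico_uminus)

lemma set_integral_dV:
  fixes g :: "real \<Rightarrow> real"
  assumes "g \<in> borel_measurable borel"
  shows "(LINT s:{a..<b}|dV V. g s) = (LINT s:{- b<..- a}|dW (halfturn V). g (- s))"
  unfolding set_lebesgue_integral_def dV_eq_distr
  using integral_distr[of uminus "dW (halfturn V)" borel "\<lambda>s. indicator {a..<b} s *\<^sub>R g s"] assms
  by (simp add: indicator_Ico_uminus)

lemma loc_int_V_iff:
  assumes "g \<in> borel_measurable borel"
  shows "loc_int_V V g \<longleftrightarrow> loc_int_W (halfturn V) (\<lambda>s. g (- s))"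
  unfolding loc_int_V_def loc_int_W_def set_integrable_dV[OF assms]
  by (metis minus_minus)

lemma prim_V_0 [simp]: "prim_V V g 0 = 0"
  by (simp add: prim_V_def halfturn_def)

lemma prim_V_diff:
  assumes "loc_int_V V g" "g \<in> borel_measurable borel" "x \<le> y"
  shows "prim_V V g y - prim_V V g x = (LINT s:{x..<y}|dV V. g s)"
  using prim_W_diff[of "halfturn V" "\<lambda>s. g (- s)" "- y" "- x"] assms
  by (simp add: loc_int_V_iff set_integral_dV prim_V_def halfturn_def)

lemma prim_V_lcont:
  assumes "loc_int_V V g" "g \<in> borel_measurable borel"
  shows "lcont (prim_V V g)"
  using prim_W_rcont[of "halfturn V" "\<lambda>s. g (- s)"] assms
  by (simp add: loc_int_V_iff prim_V_def rcont_halfturn[symmetric])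

locale left_weight =
  fixes V :: "real \<Rightarrow> real"
  assumes smono_V: "strict_mono V" and cagl: "caglad V"
begin

sublocale mirrored: weight "halfturn V"
  by standard (use smono_V cagl in \<open>auto simp: cadlag_halfturn strict_mono_def halfturn_def\<close>)

lemma emeasure_Ico: "a \<le> b \<Longrightarrow> emeasure (dV V) {a..<b} = ennreal (V b - V a)"
  by (rule emeasure_dV_Ico[OF strict_mono_mono[OF smono_V] cagl])

lemma finite_Ico: "emeasure (dV V) {a..<b} < \<infinity>"
  using emeasure_Ico[of a b] by (cases "a \<le> b") auto

lemma sigma_finite_dV: "sigma_finite_measure (dV V)"
proof (unfold_locales, intro exI conjI)
  let ?A = "range (\<lambda>n::nat. {- real n..<real n})"
  show "countable ?A" "?A \<subseteq> sets (dV V)" by auto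
  show "\<Union>?A = space (dV V)"
  proof safe
    fix x :: real
    obtain n where "\<bar>x\<bar> < real n" using reals_Archimedean2 by blast
    then show "x \<in> \<Union>?A" by (auto intro!: exI[of _ n])
  qed simp
  show "\<forall>a\<in>?A. emeasure (dV V) a \<noteq> \<infinity>" using finite_Ico by (auto simp: less_top)
qed

lemma loc_int_V_bounded:
  assumes "g \<in> borel_measurable borel" "\<And>a b. \<exists>C. \<forall>x\<in>{a..b}. \<bar>g x\<bar> \<le> C"
  shows "loc_int_V V g"
  unfolding loc_int_V_iff[OF assms(1)]
proof (rule mirrored.loc_int_bounded)
  show "(\<lambda>s. g (- s)) \<in> borel_measurable borel" using assms(1) by measurable
  fix a b :: real
  obtain C where "\<forall>x\<in>{- b..- a}. \<bar>g x\<bar> \<le> C" using assms(2) by blast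
  then show "\<exists>C. \<forall>x\<in>{a..b}. \<bar>g (- x)\<bar> \<le> C" by (intro exI[of _ C]) auto
qed

lemma prim_V_right_deriv:
  assumes "loc_int_V V g" "g \<in> borel_measurable borel" "(g \<longlongrightarrow> g x) (at_right x)"
  shows "has_right_deriv V (prim_V V g) x (g x)"
proof -
  have "((\<lambda>s. g (- s)) \<longlongrightarrow> g (- (- x))) (at_left (- x))"
    using assms(3) by (simp add: tendsto_at_left_mirror)
  then show ?thesis
    using mirrored.prim_W_left_deriv[of "\<lambda>s. g (- s)" "- x"] assms
    by (simp add: has_right_deriv_halfturn prim_V_def loc_int_V_iff)
qed

lemma caglad_if_right_deriv:
  assumes "lcont f" "\<And>x. has_right_deriv V f x (g x)"
  shows "caglad f"
  unfolding cadlag_halfturn[symmetric]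
proof (rule mirrored.cadlag_if_left_deriv)
  show "rcont (halfturn f)" using assms(1) by (simp add: rcont_halfturn)
  show "has_left_deriv (halfturn V) (halfturn f) x (g (- x))" for x
    using assms(2)[of "- x"] by (simp add: has_right_deriv_halfturn)
qed

lemma fundamental_theorem_V:
  assumes "lcont f" "\<And>x. has_right_deriv V f x (g x)" "rcont g" "loc_int_V V g"
  shows "f x = f 0 + prim_V V g x"
proof -
  have "f x - f 0 = prim_V V g x - prim_V V g 0"
    using assms by (intro right_deriv_unique[OF smono_V caglad_lcont[OF cagl] _ prim_V_lcont _ prim_V_right_deriv])
      (auto simp: rcont_def intro: rcont_measurable[unfolded rcont_def])
  then show ?thesis by simp
qed

end

section \<open>Symmetry of the Laplacian\<close>

lemma L2_D:
  assumes "f \<in> L2 V"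
  shows "f \<in> borel_measurable borel" "periodic1 f" "set_integrable (dV V) {0..<1} (\<lambda>x. (f x)\<^sup>2)"
  using assms by (auto simp: L2_def)

lemma set_borel_measurable_dV:
  "f \<in> borel_measurable borel \<Longrightarrow> A \<in> sets borel \<Longrightarrow> set_borel_measurable (dV V) A f" for f :: "real \<Rightarrow> real"
  by (simp add: set_borel_measurable_def)

lemma L2_mult_integrable:
  assumes "f \<in> L2 V" "g \<in> L2 V"
  shows "set_integrable (dV V) {0..<1} (\<lambda>x. f x * g x)"
proof (rule set_integrable_bound)
  show "set_integrable (dV V) {0..<1} (\<lambda>x. (f x)\<^sup>2 + (g x)\<^sup>2)"
    using assms by (intro set_integral_add) (auto simp: L2_def)
  show "set_borel_measurable (dV V) {0..<1} (\<lambda>x. f x * g x)"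
    using L2_D(1)[OF assms(1)] L2_D(1)[OF assms(2)] by (intro set_borel_measurable_dV) auto
  show "AE x in dV V. x \<in> {0..<1} \<longrightarrow> norm (f x * g x) \<le> norm ((f x)\<^sup>2 + (g x)\<^sup>2)"
  proof (intro AE_I2 impI)
    fix x
    have "0 \<le> (\<bar>f x\<bar> - \<bar>g x\<bar>)\<^sup>2" by simp
    then have "2 * (\<bar>f x\<bar> * \<bar>g x\<bar>) \<le> (f x)\<^sup>2 + (g x)\<^sup>2" by (simp add: power2_diff)
    moreover have "0 \<le> \<bar>f x\<bar> * \<bar>g x\<bar>" by (rule mult_nonneg_nonneg) simp_all
    ultimately have "\<bar>f x\<bar> * \<bar>g x\<bar> \<le> (f x)\<^sup>2 + (g x)\<^sup>2" by linarith
    then show "norm (f x * g x) \<le> norm ((f x)\<^sup>2 + (g x)\<^sup>2)"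
      by (simp add: abs_mult)
  qed
qed

lemma L2_cmult:
  assumes "f \<in> L2 V"
  shows "(\<lambda>x. c * f x) \<in> L2 V"
  using assms by (auto simp: L2_def periodic1_def power_mult_distrib)

lemma L2_add:
  assumes "f \<in> L2 V" "g \<in> L2 V"
  shows "(\<lambda>x. f x + g x) \<in> L2 V"
proof -
  have "set_integrable (dV V) {0..<1} (\<lambda>x. (f x)\<^sup>2 + (2 * (f x * g x) + (g x)\<^sup>2))"
    using L2_mult_integrable[OF assms] assms
    by (intro set_integral_add set_integrable_mult_right) (auto simp: L2_def)
  then show ?thesis
    using assms by (auto simp: L2_def periodic1_def power2_sum algebra_simps)
qed

lemma inner_V_commute: "inner_V V f g = inner_V V g f"
  by (simp add: inner_V_def mult.commute)

lemma inner_V_add: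
  assumes "f \<in> L2 V" "g \<in> L2 V" "h \<in> L2 V"
  shows "inner_V V (\<lambda>x. f x + g x) h = inner_V V f h + inner_V V g h"
  unfolding inner_V_def distrib_right
  using assms by (intro set_integral_add(2) L2_mult_integrable)

lemma inner_V_cmult: "inner_V V (\<lambda>x. c * f x) h = c * inner_V V f h"
  by (simp add: inner_V_def mult.assoc)

lemma inner_V_cong:
  assumes "f \<in> borel_measurable borel" "f' \<in> borel_measurable borel" "h \<in> borel_measurable borel"
    "AE_torus V (\<lambda>x. f x = f' x)"
  shows "inner_V V f h = inner_V V f' h"
  unfolding inner_V_def
  using assms by (intro set_lebesgue_integral_cong_AE) (auto simp: AE_torus_def)

locale torus_weights = weight W + left_weight V for W V :: "real \<Rightarrow> real" +
  assumes W_shift: "\<And>x. W (x + 1) - W x = W 1 - W 0"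
    and V_shift: "\<And>x. V (x + 1) - V x = V 1 - V 0"
    and W_0: "W 0 = 0"
begin

sublocale pair_sigma_finite "dW W" "dV V"
  by (intro pair_sigma_finite.intro sigma_finite_dW sigma_finite_dV)

lemma L2_bounded:
  assumes "f \<in> borel_measurable borel" "periodic1 f" "\<And>a b. \<exists>C. \<forall>x\<in>{a..b}. \<bar>f x\<bar> \<le> C"
  shows "f \<in> L2 V"
proof -
  have "loc_int_V V (\<lambda>x. (f x)\<^sup>2)"
  proof (rule loc_int_V_bounded)
    show "(\<lambda>x. (f x)\<^sup>2) \<in> borel_measurable borel" using assms(1) by measurable
    fix a b :: real
    obtain C where "\<forall>x\<in>{a..b}. \<bar>f x\<bar> \<le> C" using assms(3) by blast
    then have "\<forall>x\<in>{a..b}. \<bar>(f x)\<^sup>2\<bar> \<le> C\<^sup>2" by (auto intro: abs_le_square_iff[THEN iffD1] simp: abs_le_square_iff[symmetric])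
    then show "\<exists>C. \<forall>x\<in>{a..b}. \<bar>(f x)\<^sup>2\<bar> \<le> C" by blast
  qed
  then show ?thesis using assms by (simp add: L2_def loc_int_V_def)
qed

lemma cadlag_L2: "cadlag f \<Longrightarrow> periodic1 f \<Longrightarrow> f \<in> L2 V"
  using cadlag_bounded by (intro L2_bounded rcont_measurable cadlag_rcont)

lemma const_L2: "(\<lambda>_. c) \<in> L2 V"
  by (rule L2_bounded) (auto simp: periodic1_def)

lemma L2_integrable: "f \<in> L2 V \<Longrightarrow> set_integrable (dV V) {0..<1} f"
  using L2_mult_integrable[OF _ const_L2[of 1]] by simp

text \<open>
  Moves the constant \<open>b = G 0\<close> of a first derivative \<open>G\<close> out of its primitive; this passes between
  \<open>a + prim_W W G x\<close> and the form in which \<open>laplacian_rel\<close> is written.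
\<close>

lemma prim_W_affine_split:
  assumes "loc_int_W W G" "0 \<le> x" and H: "\<And>y. y \<in> {0<..x} \<Longrightarrow> G y - b = H y"
  shows "prim_W W G x = b * W x + (LINT y:{0<..x}|dW W. H y)"
proof -
  have const: "set_integrable (dW W) {0<..x} (\<lambda>_. b)"
    using finite_Ioc[of 0 x] by (auto simp: set_integrable_def)
  have int: "set_integrable (dW W) {0<..x} G" using assms(1) by (simp add: loc_int_W_def)
  have "prim_W W G x = (LINT y:{0<..x}|dW W. b + (G y - b))"
    using assms(2) by (simp add: prim_W_def)
  also have "\<dots> = (LINT y:{0<..x}|dW W. b) + (LINT y:{0<..x}|dW W. G y - b)"
    using const int by (intro set_integral_add(2) set_integral_diff(1))
  also have "(LINT y:{0<..x}|dW W. b) = b * W x"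
    using finite_Ioc[of 0 x] measure_Ioc[of 0 x] assms(2) W_0 by (simp add: set_integral_const less_top)
  also have "(LINT y:{0<..x}|dW W. G y - b) = (LINT y:{0<..x}|dW W. H y)"
    using H by (intro set_lebesgue_integral_cong) auto
  finally show ?thesis .
qed

text \<open>
  A function in the domain is, up to a null set, the primitive of a bounded left-continuous function
  \<open>G\<close> with zero integral over a period.  Cutting \<open>g\<close> off outside \<open>[0, 1)\<close> makes it globally
  integrable, so its primitive is bounded on the whole line, and changes nothing on \<open>[0, 1]\<close>.
\<close>

lemma laplacian_rel_primitive:
  assumes "laplacian_rel W V f g"
  obtains a b C G where "lcont G" "loc_int_W W G" "\<forall>y. \<bar>G y\<bar> \<le> C"
    "AE_torus V (\<lambda>x. f x = a + prim_W W G x)" "prim_W W G 1 = 0"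
    "\<forall>y\<in>{0..1}. G y = b + (LINT s:{0..<y}|dV V. g s)"
proof -
  obtain a b where
    fab: "AE_torus V (\<lambda>x. f x = a + b * W x + (LINT y:{0<..x}|dW W. (LINT s:{0..<y}|dV V. g s)))"
    and cond: "b * W 1 + (LINT y:{0<..1}|dW W. (LINT s:{0..<y}|dV V. g s)) = 0"
    and g: "g \<in> L2 V"
    using assms by (auto simp: laplacian_rel_def L2_zero_mean_def)
  define g1 where "g1 s = indicator {0..<1} s * g s" for s
  have g1_meas [measurable]: "g1 \<in> borel_measurable borel"
    using L2_D(1)[OF g] unfolding g1_def by measurable
  have g1_int: "integrable (dV V) g1"
    using L2_integrable[OF g] by (simp add: set_integrable_def g1_def[abs_def])
  have g1_loc: "loc_int_V V g1"
    unfolding loc_int_V_def set_integrable_def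
    using g1_int by (intro allI integrable_mult_indicator) auto
  have g1_eq: "(LINT s:{0..<y}|dV V. g1 s) = (LINT s:{0..<y}|dV V. g s)" if "y \<le> 1" for y
    using that by (intro set_lebesgue_integral_cong) (auto simp: g1_def)
  define K where "K = (LINT s|dV V. \<bar>g1 s\<bar>)"
  have K: "\<bar>LINT s:A|dV V. g1 s\<bar> \<le> K" if "A \<in> sets borel" for A
  proof -
    have "\<bar>LINT s:A|dV V. g1 s\<bar> \<le> (LINT s|dV V. \<bar>indicat_real A s *\<^sub>R g1 s\<bar>)"
      unfolding set_lebesgue_integral_def real_norm_def[symmetric] by (rule integral_norm_bound)
    also have "\<dots> \<le> K" unfolding K_def
      using g1_int that by (intro integral_mono integrable_abs integrable_mult_indicator) (auto simp: indicator_def)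
    finally show ?thesis .
  qed
  define G where "G y = b + prim_V V g1 y" for y
  have bd: "\<bar>G y\<bar> \<le> \<bar>b\<bar> + K" for y
  proof -
    have "\<bar>prim_V V g1 y\<bar> \<le> K"
      using prim_V_diff[OF g1_loc g1_meas, of 0 y] prim_V_diff[OF g1_loc g1_meas, of y 0]
        K[of "{0..<y}"] K[of "{y..<0}"] by (cases "0 \<le> y") auto
    then show ?thesis unfolding G_def by linarith
  qed
  have G_lcont: "lcont G"
    using prim_V_lcont[OF g1_loc g1_meas] by (auto simp: lcont_def G_def[abs_def] intro!: tendsto_intros)
  have G_loc: "loc_int_W W G"
    using bd by (intro loc_int_bounded lcont_measurable G_lcont) blast
  have G_eq: "G y = b + (LINT s:{0..<y}|dV V. g s)" if "y \<in> {0..1}" for y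
    using prim_V_diff[OF g1_loc g1_meas, of 0 y] g1_eq[of y] that by (simp add: G_def)
  have prim: "prim_W W G x = b * W x + (LINT y:{0<..x}|dW W. (LINT s:{0..<y}|dV V. g s))"
    if x: "x \<in> {0..1}" for x
    using x by (intro prim_W_affine_split G_loc) (auto simp: G_eq)
  have "AE_torus V (\<lambda>x. f x = a + prim_W W G x)"
    using fab unfolding AE_torus_def by eventually_elim (auto simp: prim)
  moreover have "prim_W W G 1 = 0" using prim[of 1] cond by simp
  ultimately show ?thesis using G_lcont G_loc bd G_eq by (intro that) auto
qed

text \<open>
  Fubini's theorem for \<open>G y * h x\<close> on the triangle \<open>0 < y \<le> x < 1\<close>.  The zero mean of \<open>h\<close> removes the
  constant \<open>a\<close> and turns the integral of \<open>h\<close> over \<open>[y, 1)\<close> into minus the integral over \<open>[0, y)\<close>.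
\<close>

lemma integration_by_parts:
  assumes f: "f \<in> L2 V" and fG: "AE_torus V (\<lambda>x. f x = a + prim_W W G x)"
    and G: "lcont G" "loc_int_W W G" and bd: "\<And>y. \<bar>G y\<bar> \<le> C" and h: "h \<in> L2_zero_mean V"
  shows "inner_V V f h = - (LINT y:{0<..1}|dW W. G y * (LINT x:{0..<y}|dV V. h x))"
proof -
  have hL2: "h \<in> L2 V" and h0: "(LINT x:{0..<1}|dV V. h x) = 0" using h by (auto simp: L2_zero_mean_def)
  have [measurable]: "f \<in> borel_measurable borel" "h \<in> borel_measurable borel" "G \<in> borel_measurable borel"
    using L2_D(1)[OF f] L2_D(1)[OF hL2] lcont_measurable[OF G(1)] by auto
  have [measurable]: "prim_W W G \<in> borel_measurable borel"
    by (intro rcont_measurable prim_W_rcont G)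
  define u where "u y = indicator {0<..1} y * G y" for y
  define v where "v x = indicator {0..<1} x * h x" for x
  have [measurable]: "u \<in> borel_measurable borel" "v \<in> borel_measurable borel"
    unfolding u_def v_def by measurable
  define k where "k y x = (if y \<le> x then u y * v x else 0)" for y x
  have u_int: "integrable (dW W) u" using G(2) by (simp add: loc_int_W_def u_def[abs_def] set_integrable_def)
  have v_int: "integrable (dV V) v" using L2_integrable[OF hL2] by (simp add: v_def[abs_def] set_integrable_def)
  \<comment> \<open>The product function on the full square dominates its restriction \<open>k\<close> to the triangle.\<close>
  have "integrable (dW W \<Otimes>\<^sub>M dV V) (\<lambda>(y, x). u y * v x)"
  proof (rule Fubini_integrable)
    show "(\<lambda>(y, x). u y * v x) \<in> borel_measurable (dW W \<Otimes>\<^sub>M dV V)" by measurable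
    show "integrable (dW W) (\<lambda>y. LINT x|dV V. norm (case (y, x) of (y, x) \<Rightarrow> u y * v x))"
      using u_int by (simp add: abs_mult)
    show "AE y in dW W. integrable (dV V) (\<lambda>x. case (y, x) of (y, x) \<Rightarrow> u y * v x)"
      using v_int by simp
  qed
  then have k_int: "integrable (dW W \<Otimes>\<^sub>M dV V) (case_prod k)"
  proof (rule Bochner_Integration.integrable_bound)
    show "case_prod k \<in> borel_measurable (dW W \<Otimes>\<^sub>M dV V)" unfolding k_def by measurable
    show "AE x in dW W \<Otimes>\<^sub>M dV V. norm (case_prod k x) \<le> norm (case x of (y, x) \<Rightarrow> u y * v x)"
      by (auto simp: k_def)
  qed
  have inner_y: "(LINT y|dW W. k y x) = indicator {0..<1} x * (prim_W W G x * h x)" for x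
  proof (cases "x \<in> {0..<1}")
    case False
    then have "k y x = 0" for y by (simp add: k_def v_def)
    with False show ?thesis by simp
  next
    case True
    have "(LINT y|dW W. k y x) = (LINT y|dW W. (indicator {0<..x} y *\<^sub>R G y) * h x)"
      using True by (intro Bochner_Integration.integral_cong) (auto simp: k_def u_def v_def indicator_def)
    also have "\<dots> = prim_W W G x * h x"
      using True by (simp add: prim_W_def set_lebesgue_integral_def)
    finally show ?thesis using True by simp
  qed
  have inner_x: "(LINT x|dV V. k y x) = indicator {0<..1} y *\<^sub>R (- (G y * (LINT x:{0..<y}|dV V. h x)))" for y
  proof (cases "y \<in> {0<..1}")
    case False
    then have "k y x = 0" for x by (simp add: k_def u_def)
    with False show ?thesis by simp
  next
    case True
    have sub: "set_integrable (dV V) {0..<y} h" "set_integrable (dV V) {y..<1} h"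
      using True by (auto intro!: set_integrable_subset[OF L2_integrable[OF hL2]])
    have "{0..<1} = {0..<y} \<union> {y..<1}" using True by auto
    then have split: "(LINT x:{0..<y}|dV V. h x) + (LINT x:{y..<1}|dV V. h x) = 0"
      using set_integral_Un[OF _ sub] h0 by auto
    have "(LINT x|dV V. k y x) = (LINT x|dV V. G y * (indicator {y..<1} x *\<^sub>R h x))"
      using True by (intro Bochner_Integration.integral_cong) (auto simp: k_def u_def v_def indicator_def)
    also have "\<dots> = G y * (LINT x:{y..<1}|dV V. h x)" by (simp add: set_lebesgue_integral_def)
    also have "\<dots> = - (G y * (LINT x:{0..<y}|dV V. h x))" using split by (simp add: eq_neg_iff_add_eq_0 distrib_left[symmetric] add.commute)
    finally show ?thesis using True by simp
  qed
  have ah: "set_integrable (dV V) {0..<1} (\<lambda>x. a * h x)"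
    using L2_integrable[OF hL2] by simp
  have ph: "set_integrable (dV V) {0..<1} (\<lambda>x. prim_W W G x * h x)"
    using integrable_snd[OF k_int] by (simp add: inner_y set_integrable_def)
  have "inner_V V f h = (LINT x:{0..<1}|dV V. a * h x + prim_W W G x * h x)"
    unfolding inner_V_def using fG
    by (intro set_lebesgue_integral_cong_AE) (auto simp: AE_torus_def algebra_simps)
  also have "\<dots> = a * (LINT x:{0..<1}|dV V. h x) + (LINT x:{0..<1}|dV V. prim_W W G x * h x)"
    using set_integral_add(2)[OF ah ph] by simp
  also have "\<dots> = (LINT x|dV V. LINT y|dW W. k y x)"
    unfolding h0 by (simp add: inner_y set_lebesgue_integral_def)
  also have "\<dots> = (LINT y|dW W. LINT x|dV V. k y x)"
    by (rule Fubini_integral[OF k_int])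
  also have "\<dots> = (LINT y:{0<..1}|dW W. - (G y * (LINT x:{0..<y}|dV V. h x)))"
    by (simp only: inner_x set_lebesgue_integral_def)
  also have "\<dots> = - (LINT y:{0<..1}|dW W. G y * (LINT x:{0..<y}|dV V. h x))"
    by (simp add: set_lebesgue_integral_def)
  finally show ?thesis .
qed

text \<open>
  After integration by parts both sides equal \<open>- \<integral> G * G' dW\<close>: the inner integral of \<open>g'\<close> is
  \<open>G' - b'\<close>, and the constant \<open>b'\<close> disappears because \<open>G\<close> has zero integral over a period.
\<close>

lemma laplacian_symmetric:
  assumes fg: "laplacian_rel W V f g" and fg': "laplacian_rel W V f' g'"
  shows "inner_V V f g' = inner_V V g f'"
proof -
  obtain a b C G where G: "lcont G" "loc_int_W W G" "\<forall>y. \<bar>G y\<bar> \<le> C"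
    "AE_torus V (\<lambda>x. f x = a + prim_W W G x)" "prim_W W G 1 = 0"
    "\<forall>y\<in>{0..1}. G y = b + (LINT s:{0..<y}|dV V. g s)"
    by (rule laplacian_rel_primitive[OF fg]) (rule that)
  obtain a' b' C' G' where G': "lcont G'" "loc_int_W W G'" "\<forall>y. \<bar>G' y\<bar> \<le> C'"
    "AE_torus V (\<lambda>x. f' x = a' + prim_W W G' x)" "prim_W W G' 1 = 0"
    "\<forall>y\<in>{0..1}. G' y = b' + (LINT s:{0..<y}|dV V. g' s)"
    by (rule laplacian_rel_primitive[OF fg']) (rule that)
  have f: "f \<in> L2 V" "g \<in> L2_zero_mean V" and f': "f' \<in> L2 V" "g' \<in> L2_zero_mean V"
    using fg fg' by (auto simp: laplacian_rel_def)
  have [measurable]: "G \<in> borel_measurable borel" "G' \<in> borel_measurable borel"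
    using G(1) G'(1) by (auto intro: lcont_measurable)
  have GG': "set_integrable (dW W) {0<..1} (\<lambda>y. G y * G' y)"
  proof -
    have "\<bar>G y * G' y\<bar> \<le> C * C'" for y
      using G(3)[rule_format, of y] G'(3)[rule_format, of y] unfolding abs_mult by (intro mult_mono) auto
    then have "loc_int_W W (\<lambda>y. G y * G' y)" by (intro loc_int_bounded) auto
    then show ?thesis by (simp add: loc_int_W_def)
  qed
  have i: "set_integrable (dW W) {0<..1} G" "set_integrable (dW W) {0<..1} G'"
    using G(2) G'(2) by (auto simp: loc_int_W_def)
  have z: "(LINT y:{0<..1}|dW W. G y) = 0" "(LINT y:{0<..1}|dW W. G' y) = 0"
    using G(5) G'(5) by (auto simp: prim_W_def)
  have "inner_V V f g' = - (LINT y:{0<..1}|dW W. G y * (LINT x:{0..<y}|dV V. g' x))"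
    by (rule integration_by_parts[OF f(1) G(4,1,2) G(3)[rule_format] f'(2)])
  also have "(LINT y:{0<..1}|dW W. G y * (LINT x:{0..<y}|dV V. g' x))
      = (LINT y:{0<..1}|dW W. G y * G' y - b' * G y)"
    by (intro set_lebesgue_integral_cong) (auto simp: G'(6)[rule_format] algebra_simps)
  also have "\<dots> = (LINT y:{0<..1}|dW W. G y * G' y)"
    using set_integral_diff(2)[OF GG' set_integrable_mult_right[OF i(1), of b']] z by simp
  also have "\<dots> = (LINT y:{0<..1}|dW W. G y * G' y - b * G' y)"
    using set_integral_diff(2)[OF GG' set_integrable_mult_right[OF i(2), of b]] z by simp
  also have "\<dots> = (LINT y:{0<..1}|dW W. G' y * (LINT x:{0..<y}|dV V. g x))"
    by (intro set_lebesgue_integral_cong) (auto simp: G(6)[rule_format] algebra_simps)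
  also have "- \<dots> = inner_V V f' g"
    by (rule integration_by_parts[OF f'(1) G'(4,1,2) G'(3)[rule_format] f(2), symmetric])
  finally show ?thesis by (simp add: inner_V_commute)
qed

end

section \<open>Smooth functions and eigenfunctions\<close>

text \<open>
  Membership in \<open>smooth_WV\<close> with the derivatives \<open>G\<close> and \<open>g\<close> exhibited, which is stable under linear
  combinations without reference to the choice of limits in \<open>left_deriv\<close> and \<open>right_deriv\<close>.  The
  one-sided limits demanded by \<open>smooth_WV\<close> on the other sides follow from differentiability
  (\<open>lateral_smooth_regular\<close>).
\<close>

definition lateral_smooth ::
  "(real \<Rightarrow> real) \<Rightarrow> (real \<Rightarrow> real) \<Rightarrow> (real \<Rightarrow> real) \<Rightarrow> (real \<Rightarrow> real) \<Rightarrow> (real \<Rightarrow> real) \<Rightarrow> bool" where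
  "lateral_smooth W V f G g \<longleftrightarrow> periodic1 f \<and> rcont f \<and> (\<forall>x. has_left_deriv W f x (G x)) \<and>
     lcont G \<and> (\<forall>x. has_right_deriv V G x (g x)) \<and> cadlag g"

lemma lateral_smooth_add:
  "lateral_smooth W V f G g \<Longrightarrow> lateral_smooth W V f' G' g' \<Longrightarrow>
   lateral_smooth W V (\<lambda>x. f x + f' x) (\<lambda>x. G x + G' x) (\<lambda>x. g x + g' x)"
  unfolding lateral_smooth_def
  by (auto simp: periodic1_def intro!: rcont_add lcont_add cadlag_add has_left_deriv_add has_right_deriv_add)

lemma lateral_smooth_cmult:
  "lateral_smooth W V f G g \<Longrightarrow> lateral_smooth W V (\<lambda>x. c * f x) (\<lambda>x. c * G x) (\<lambda>x. c * g x)"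
  unfolding lateral_smooth_def
  by (auto simp: periodic1_def intro!: rcont_cmult lcont_cmult cadlag_cmult has_left_deriv_cmult has_right_deriv_cmult)

lemma lateral_smooth_const: "lateral_smooth W V (\<lambda>_. c) (\<lambda>_. 0) (\<lambda>_. 0)"
  by (auto simp: lateral_smooth_def periodic1_def rcont_def lcont_def cadlag_def
      has_left_deriv_const has_right_deriv_const)

lemma lateral_smooth_derivs:
  assumes "lateral_smooth W V f G g"
  shows "left_deriv W f = G" "right_deriv V G = g"
  using assms by (auto simp: lateral_smooth_def fun_eq_iff intro: left_deriv_eq right_deriv_eq)

context torus_weights
begin

lemma lateral_smooth_regular:
  assumes "lateral_smooth W V f G g"
  shows "cadlag f" "caglad G" "cadlag g"
  using assms cadlag_if_left_deriv[of f G] caglad_if_right_deriv[of G g]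
  by (auto simp: lateral_smooth_def)

lemma smooth_WV_iff: "f \<in> smooth_WV W V \<longleftrightarrow> (\<exists>G g. lateral_smooth W V f G g)"
proof
  assume f: "f \<in> smooth_WV W V"
  have "has_left_deriv W f x (left_deriv W f x)" for x
  proof -
    obtain l where "has_left_deriv W f x l"
      using f by (auto simp: smooth_WV_def left_differentiable_def has_left_deriv_def)
    then show ?thesis using left_deriv_eq by metis
  qed
  moreover have "has_right_deriv V (left_deriv W f) x (right_deriv V (left_deriv W f) x)" for x
  proof -
    obtain l where "has_right_deriv V (left_deriv W f) x l"
      using f by (auto simp: smooth_WV_def right_differentiable_def has_right_deriv_def)
    then show ?thesis using right_deriv_eq by metis
  qed
  ultimately have "lateral_smooth W V f (left_deriv W f) (right_deriv V (left_deriv W f))"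
    using f by (auto simp: lateral_smooth_def smooth_WV_def cadlag_rcont caglad_lcont)
  then show "\<exists>G g. lateral_smooth W V f G g" by blast
next
  assume "\<exists>G g. lateral_smooth W V f G g"
  then obtain G g where s: "lateral_smooth W V f G g" by blast
  have "left_differentiable W f"
    using s unfolding left_differentiable_def has_left_deriv_def[symmetric] lateral_smooth_def by blast
  moreover have "right_differentiable V G"
    using s unfolding right_differentiable_def has_right_deriv_def[symmetric] lateral_smooth_def by blast
  ultimately show "f \<in> smooth_WV W V"
    using s lateral_smooth_regular[OF s] by (simp add: smooth_WV_def lateral_smooth_derivs[OF s] lateral_smooth_def)
qed

text \<open>
  The increments of \<open>W\<close> and \<open>V\<close> are periodic, so differentiation commutes with the shift by 1.
\<close>

lemma lateral_smooth_periodic: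
  assumes "lateral_smooth W V f G g"
  shows "periodic1 G" "periodic1 g"
proof -
  have shift: "(\<lambda>x. f (x + 1)) = f" using assms by (auto simp: lateral_smooth_def periodic1_def fun_eq_iff)
  have G: "G (x + 1) = G x" for x
  proof -
    have "has_left_deriv W (\<lambda>x. f (x + 1)) x (G (x + 1))"
      using assms by (intro has_left_deriv_shift[OF W_shift]) (simp add: lateral_smooth_def)
    from left_deriv_eq[OF this] show ?thesis
      by (simp add: shift lateral_smooth_derivs(1)[OF assms])
  qed
  then have shift': "(\<lambda>x. G (x + 1)) = G" by (simp add: fun_eq_iff)
  have "g (x + 1) = g x" for x
  proof -
    have "has_right_deriv V (\<lambda>x. G (x + 1)) x (g (x + 1))"
      using assms by (intro has_right_deriv_shift[OF V_shift]) (simp add: lateral_smooth_def)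
    from right_deriv_eq[OF this] show ?thesis
      by (simp add: shift' lateral_smooth_derivs(2)[OF assms])
  qed
  with G show "periodic1 G" "periodic1 g" by (auto simp: periodic1_def)
qed

text \<open>
  The fundamental theorem, applied twice, gives the integral formula; periodicity of \<open>f\<close> and of \<open>G\<close>
  gives the two vanishing integrals.
\<close>

lemma lateral_smooth_laplacian:
  assumes s: "lateral_smooth W V f G g"
  shows "laplacian_rel W V f g"
proof -
  note reg = lateral_smooth_regular[OF s] and per = lateral_smooth_periodic[OF s]
  have g_meas: "g \<in> borel_measurable borel" using reg(3) by (intro rcont_measurable cadlag_rcont)
  have G_loc: "loc_int_W W G"
    using reg(2) caglad_bounded by (intro loc_int_bounded lcont_measurable caglad_lcont)
  have g_loc: "loc_int_V V g"
    using reg(3) cadlag_bounded by (intro loc_int_V_bounded g_meas)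
  have f_eq: "f x = f 0 + prim_W W G x" for x
    using s G_loc by (intro fundamental_theorem_W) (auto simp: lateral_smooth_def)
  have G_eq: "G y = G 0 + prim_V V g y" for y
    using s g_loc by (intro fundamental_theorem_V) (auto simp: lateral_smooth_def cadlag_rcont)
  have G_eq': "G y - G 0 = (LINT s:{0..<y}|dV V. g s)" if "0 \<le> y" for y
    using G_eq[of y] prim_V_diff[OF g_loc g_meas that] by simp
  have prim: "prim_W W G x = G 0 * W x + (LINT y:{0<..x}|dW W. (LINT s:{0..<y}|dV V. g s))"
    if x: "0 \<le> x" for x
    using x by (intro prim_W_affine_split G_loc G_eq') auto
  have "f 1 = f 0" "G 1 = G 0"
    using s per(1) by (auto simp: lateral_smooth_def periodic1_def dest: spec[of _ 0])
  then have ends: "prim_W W G 1 = 0" "(LINT s:{0..<1}|dV V. g s) = 0"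
    using f_eq[of 1] G_eq'[of 1] by auto
  have f_rep: "f x = f 0 + G 0 * W x + (LINT y:{0<..x}|dW W. (LINT s:{0..<y}|dV V. g s))" if "0 \<le> x" for x
    using f_eq[of x] prim[OF that] by simp
  have "AE_torus V (\<lambda>x. f x = f 0 + G 0 * W x + (LINT y:{0<..x}|dW W. (LINT s:{0..<y}|dV V. g s)))"
    unfolding AE_torus_def by (intro AE_I2 impI f_rep) simp
  moreover have "f \<in> L2 V" "g \<in> L2 V"
    using s reg per by (auto intro: cadlag_L2 simp: lateral_smooth_def)
  ultimately show ?thesis
    unfolding laplacian_rel_def L2_zero_mean_def using prim[of 1] ends by auto
qed

text \<open>
  The only global point is periodicity.  A shift by 1 does not change the derivative of the primitive,
  hence changes the primitive by a constant, and this constant is an integral over \<open>[0, 1)\<close> or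
  \<open>(0, 1]\<close> that vanishes by hypothesis.
\<close>

lemma lateral_smooth_primitive:
  assumes h: "cadlag h" "periodic1 h" and h0: "(LINT s:{0..<1}|dV V. h s) = 0"
    and zero: "prim_W W (\<lambda>y. b + prim_V V h y) 1 = 0"
  shows "lateral_smooth W V (\<lambda>x. a + prim_W W (\<lambda>y. b + prim_V V h y) x) (\<lambda>y. b + prim_V V h y) h"
proof -
  define G where "G y = b + prim_V V h y" for y
  define F where "F x = a + prim_W W G x" for x
  have h_meas: "h \<in> borel_measurable borel" using h(1) by (intro rcont_measurable cadlag_rcont)
  have h_loc: "loc_int_V V h" using h(1) cadlag_bounded by (intro loc_int_V_bounded h_meas)
  have G_lcont: "lcont G"
    using prim_V_lcont[OF h_loc h_meas] by (auto simp: lcont_def G_def[abs_def] intro!: tendsto_intros)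
  have G_der: "has_right_deriv V G x (h x)" for x
    using has_right_deriv_add[OF has_right_deriv_const[of V b x] prim_V_right_deriv[OF h_loc h_meas, of x]] h(1)
    by (simp add: G_def[abs_def] cadlag_def)
  have G_loc: "loc_int_W W G"
    using caglad_bounded[OF caglad_if_right_deriv[OF G_lcont G_der]]
    by (intro loc_int_bounded lcont_measurable G_lcont)
  have F_rcont: "rcont F"
    using prim_W_rcont[OF G_loc] by (auto simp: rcont_def F_def[abs_def] intro!: tendsto_intros)
  have F_der: "has_left_deriv W F x (G x)" for x
    using has_left_deriv_add[OF has_left_deriv_const[of W a x] prim_W_left_deriv[OF G_loc, of x]] G_lcont
    by (simp add: F_def[abs_def] lcont_def)
  have shift_l: "lcont (\<lambda>x. G (x + 1))"
    using G_lcont by (simp add: lcont_def tendsto_at_left_shift)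
  have shift_r: "rcont (\<lambda>x. F (x + 1))"
    using F_rcont by (simp add: rcont_def tendsto_at_right_shift)
  have "G (x + 1) = G x" for x
  proof -
    have "has_right_deriv V (\<lambda>x. G (x + 1)) x (h x)" for x
      using has_right_deriv_shift[OF V_shift G_der] h(2) by (simp add: periodic1_def)
    then have "G (x + 1) - G (0 + 1) = G x - G 0"
      using G_lcont shift_l G_der by (intro right_deriv_unique[OF smono_V caglad_lcont[OF cagl]])
    moreover have "G 1 = G 0"
      using prim_V_diff[OF h_loc h_meas, of 0 1] h0 by (simp add: G_def)
    ultimately show ?thesis by simp
  qed
  have "F (x + 1) = F x" for x
  proof -
    have "has_left_deriv W (\<lambda>x. F (x + 1)) x (G x)" for x
      using has_left_deriv_shift[OF W_shift F_der] \<open>\<And>x. G (x + 1) = G x\<close> by simp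
    then have "F (x + 1) - F (0 + 1) = F x - F 0"
      using F_rcont shift_r F_der by (intro left_deriv_unique[OF smono rcont_weight])
    moreover have "F 1 = F 0" using zero by (simp add: F_def G_def[abs_def])
    ultimately show ?thesis by simp
  qed
  then have "lateral_smooth W V F G h"
    using F_rcont F_der G_lcont G_der h(1) by (simp add: lateral_smooth_def periodic1_def)
  then show ?thesis by (simp add: F_def[abs_def] G_def[abs_def])
qed

text \<open>
  The integral formula gives a cadlag representative \<open>P\<close> of \<open>u\<close> on \<open>[0, 1)\<close>, hence the cadlag periodic
  representative \<open>h = - l * P\<close> of \<open>g\<close>.  Inserting \<open>h\<close> for \<open>g\<close> in the formula does not change its value
  on \<open>[0, 1]\<close>, but now it is the double primitive of a cadlag function.
\<close>

lemma eigenfunction_smooth_representative: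
  assumes rel: "laplacian_rel W V u g" and eig: "AE_torus V (\<lambda>x. - g x = l * u x)"
  shows "\<exists>f\<in>smooth_WV W V. AE_torus V (\<lambda>x. f x = u x)"
proof -
  obtain a b C G where G: "lcont G" "loc_int_W W G" "\<forall>y. \<bar>G y\<bar> \<le> C"
    "AE_torus V (\<lambda>x. u x = a + prim_W W G x)" "prim_W W G 1 = 0"
    "\<forall>y\<in>{0..1}. G y = b + (LINT s:{0..<y}|dV V. g s)"
    by (rule laplacian_rel_primitive[OF rel]) (rule that)
  have g: "g \<in> L2_zero_mean V" using rel by (simp add: laplacian_rel_def)
  have g_meas: "g \<in> borel_measurable borel" using g by (auto simp: L2_zero_mean_def L2_def)
  define P where "P x = a + prim_W W G x" for x
  define h where "h x = - l * P (frac x)" for x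
  have "cadlag P"
  proof (rule cadlag_if_left_deriv)
    show "rcont P"
      using prim_W_rcont[OF G(2)] by (auto simp: rcont_def P_def[abs_def] intro!: tendsto_intros)
    show "has_left_deriv W P x (G x)" for x
      using has_left_deriv_add[OF has_left_deriv_const[of W a x] prim_W_left_deriv[OF G(2), of x]] G(1)
      by (simp add: P_def[abs_def] lcont_def)
  qed
  then have h_cadlag: "cadlag h"
    unfolding h_def by (intro cadlag_cmult cadlag_periodic_extension)
  have h_per: "periodic1 h" by (simp add: periodic1_def h_def frac_def)
  have h_meas: "h \<in> borel_measurable borel" using h_cadlag by (intro rcont_measurable cadlag_rcont)
  have h_loc: "loc_int_V V h" using h_cadlag cadlag_bounded by (intro loc_int_V_bounded h_meas)
  have hg: "AE x in dV V. x \<in> {0..<1} \<longrightarrow> h x = g x"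
    using eig G(4) unfolding AE_torus_def
  proof eventually_elim
    case (elim x)
    show ?case
    proof
      assume x: "x \<in> {0..<1}"
      then have "frac x = x" by (simp add: frac_eq)
      then show "h x = g x" using elim x by (simp add: h_def P_def)
    qed
  qed
  have int_eq: "(LINT s:{0..<y}|dV V. h s) = (LINT s:{0..<y}|dV V. g s)" if "y \<le> 1" for y
    using hg that h_meas g_meas by (intro set_lebesgue_integral_cong_AE) (auto elim!: eventually_mono)
  have G_eq: "b + prim_V V h y = G y" if "y \<in> {0..1}" for y
    using prim_V_diff[OF h_loc h_meas, of 0 y] that int_eq[of y] G(6) by auto
  have prim_eq: "prim_W W (\<lambda>y. b + prim_V V h y) x = prim_W W G x" if "x \<in> {0..1}" for x
    using that G_eq unfolding prim_W_def by (auto intro!: set_lebesgue_integral_cong)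
  have "(LINT s:{0..<1}|dV V. h s) = 0"
    using int_eq[of 1] g by (simp add: L2_zero_mean_def)
  then have "lateral_smooth W V (\<lambda>x. a + prim_W W (\<lambda>y. b + prim_V V h y) x) (\<lambda>y. b + prim_V V h y) h"
    using h_cadlag h_per prim_eq[of 1] G(5) by (intro lateral_smooth_primitive) auto
  then have "(\<lambda>x. a + prim_W W (\<lambda>y. b + prim_V V h y) x) \<in> smooth_WV W V"
    unfolding smooth_WV_iff by blast
  moreover have "AE_torus V (\<lambda>x. a + prim_W W (\<lambda>y. b + prim_V V h y) x = u x)"
    using G(4) unfolding AE_torus_def by eventually_elim (auto simp: prim_eq)
  ultimately show ?thesis
    by (intro bexI[of _ "\<lambda>x. a + prim_W W (\<lambda>y. b + prim_V V h y) x"])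
qed

end

section \<open>Parseval identity for the energy\<close>

lemma L2_diff:
  assumes "f \<in> L2 V" "g \<in> L2 V"
  shows "(\<lambda>x. f x - g x) \<in> L2 V"
  using L2_add[OF assms(1) L2_cmult[OF assms(2), of "- 1"]] by simp

lemma L2_zero: "(\<lambda>_. 0) \<in> L2 V"
  by (auto simp: L2_def periodic1_def set_integrable_def)

lemma L2_sum:
  assumes "finite I" "\<And>i. i \<in> I \<Longrightarrow> u i \<in> L2 V"
  shows "(\<lambda>x. \<Sum>i\<in>I. u i x) \<in> L2 V"
  using assms by (induction I rule: finite_induct) (auto intro: L2_zero L2_add)

lemma inner_V_diff:
  assumes "f \<in> L2 V" "g \<in> L2 V" "h \<in> L2 V"
  shows "inner_V V (\<lambda>x. f x - g x) h = inner_V V f h - inner_V V g h"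
  using inner_V_add[OF assms(1) L2_cmult[OF assms(2), of "- 1"] assms(3)] inner_V_cmult[of V "- 1" g h] by simp

lemma inner_V_sum:
  assumes "finite I" "\<And>i. i \<in> I \<Longrightarrow> u i \<in> L2 V" "h \<in> L2 V"
  shows "inner_V V (\<lambda>x. \<Sum>i\<in>I. u i x) h = (\<Sum>i\<in>I. inner_V V (u i) h)"
  using assms
proof (induction I rule: finite_induct)
  case empty
  then show ?case by (simp add: inner_V_def)
next
  case (insert i I)
  then show ?case by (simp add: inner_V_add L2_sum)
qed

lemma inner_V_self_nonneg: "0 \<le> inner_V V f f"
  unfolding inner_V_def set_lebesgue_integral_def by (intro integral_nonneg_AE) (auto simp: indicator_def)

text \<open>
  The discriminant of the nonnegative quadratic \<open>t \<mapsto> \<parallel>f + t g\<parallel>\<^sup>2\<close>; when \<open>\<parallel>g\<parallel> = 0\<close> it is affine in \<open>t\<close>,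
  which forces the linear coefficient to vanish.
\<close>

lemma Cauchy_Schwarz_V:
  assumes f: "f \<in> L2 V" and g: "g \<in> L2 V"
  shows "\<bar>inner_V V f g\<bar> \<le> norm_V V f * norm_V V g"
proof -
  define a b c where "a = inner_V V f f" and "b = inner_V V f g" and "c = inner_V V g g"
  have quad: "0 \<le> a + 2 * t * b + t\<^sup>2 * c" for t
  proof -
    have tg: "(\<lambda>x. t * g x) \<in> L2 V" using g by (rule L2_cmult)
    have "inner_V V (\<lambda>x. f x + t * g x) (\<lambda>x. f x + t * g x)
        = inner_V V f (\<lambda>x. f x + t * g x) + t * inner_V V g (\<lambda>x. f x + t * g x)"
      using f g tg by (simp add: inner_V_add L2_add inner_V_cmult)
    also have "inner_V V f (\<lambda>x. f x + t * g x) = a + t * b"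
      using inner_V_add[OF f tg f]
      unfolding inner_V_cmult inner_V_commute[of V f "\<lambda>x. f x + t * g x"] inner_V_commute[of V g f] a_def b_def .
    also have "inner_V V g (\<lambda>x. f x + t * g x) = b + t * c"
      using inner_V_add[OF f tg g]
      unfolding inner_V_cmult inner_V_commute[of V g "\<lambda>x. f x + t * g x"] b_def c_def .
    finally show ?thesis
      using inner_V_self_nonneg[of V "\<lambda>x. f x + t * g x"] by (simp add: algebra_simps power2_eq_square)
  qed
  have "b\<^sup>2 \<le> a * c"
  proof (cases "c = 0")
    case True
    have "b = 0"
    proof (rule ccontr)
      assume "b \<noteq> 0"
      then show False using quad[of "- (a + 1) / (2 * b)"] True by (simp add: field_simps)
    qed
    with True show ?thesis by simp
  next
    case False
    then have "c > 0" using inner_V_self_nonneg[of V g] by (simp add: c_def)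
    then show ?thesis using quad[of "- b / c"] by (simp add: field_simps power2_eq_square)
  qed
  then have "\<bar>b\<bar> \<le> sqrt (a * c)" by (simp add: real_le_rsqrt)
  then show ?thesis by (simp add: norm_V_def real_sqrt_mult a_def b_def c_def)
qed

lemma L2_converges_inner:
  assumes F: "\<And>n. F n \<in> L2 V" and f: "f \<in> L2 V" and h: "h \<in> L2 V" and lim: "L2_converges V F f"
  shows "(\<lambda>n. inner_V V (F n) h) \<longlonglongrightarrow> inner_V V f h"
proof (rule LIM_zero_cancel, rule tendsto_rabs_zero_cancel,
    rule tendsto_sandwich[of "\<lambda>_. 0" _ _ "\<lambda>n. norm_V V (\<lambda>x. F n x - f x) * norm_V V h"])
  have "(\<lambda>n. norm_V V (\<lambda>x. F n x - f x) * norm_V V h) \<longlonglongrightarrow> 0 * norm_V V h"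
    using lim unfolding L2_converges_def by (intro tendsto_intros)
  then show "(\<lambda>n. norm_V V (\<lambda>x. F n x - f x) * norm_V V h) \<longlonglongrightarrow> 0" by simp
  show "\<forall>\<^sub>F n in sequentially. \<bar>inner_V V (F n) h - inner_V V f h\<bar> \<le> norm_V V (\<lambda>x. F n x - f x) * norm_V V h"
    using Cauchy_Schwarz_V[OF L2_diff[OF F f] h] inner_V_diff[OF F f h] by simp
qed auto

lemma L2_converges_cong:
  assumes "\<And>n. F n \<in> borel_measurable borel" "\<And>n. F' n \<in> borel_measurable borel" "f \<in> borel_measurable borel"
    and ae: "\<And>n. AE_torus V (\<lambda>x. F n x = F' n x)" and lim: "L2_converges V F f"
  shows "L2_converges V F' f"
proof -
  have "norm_V V (\<lambda>x. F' n x - f x) = norm_V V (\<lambda>x. F n x - f x)" for n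
    unfolding norm_V_def inner_V_def using assms(1,2)[of n] assms(3) ae[of n]
    by (intro arg_cong[where f = sqrt] set_lebesgue_integral_cong_AE) (auto simp: AE_torus_def)
  then show ?thesis using lim by (simp add: L2_converges_def)
qed

lemma Parseval:
  assumes \<nu>: "complete_orthonormal V \<nu>" and f: "f \<in> L2 V" and h: "h \<in> L2 V"
  shows "(\<lambda>i. inner_V V f (\<nu> i) * inner_V V h (\<nu> i)) sums inner_V V f h"
proof -
  have \<nu>L2: "\<nu> i \<in> L2 V" for i using \<nu> by (simp add: complete_orthonormal_def)
  have term_L2: "(\<lambda>x. inner_V V f (\<nu> i) * \<nu> i x) \<in> L2 V" for i by (rule L2_cmult[OF \<nu>L2])
  have "(\<lambda>n. inner_V V (\<lambda>x. \<Sum>i<n. inner_V V f (\<nu> i) * \<nu> i x) h) \<longlonglongrightarrow> inner_V V f h"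
    using \<nu> f h by (intro L2_converges_inner L2_sum term_L2) (auto simp: complete_orthonormal_def)
  then show ?thesis
    unfolding sums_def inner_V_sum[OF finite_lessThan term_L2 h] inner_V_cmult
    by (simp only: inner_V_commute[of V h])
qed

locale torus_spectrum = torus_weights W V for W V +
  fixes \<nu> :: "nat \<Rightarrow> real \<Rightarrow> real" and ev :: "nat \<Rightarrow> real"
  assumes complete: "complete_orthonormal V \<nu>"
    and domain: "\<And>i. \<nu> i \<in> laplacian_domain W V"
    and eigen: "\<And>i. AE_torus V (\<lambda>x. - laplacian W V (\<nu> i) x = ev i * \<nu> i x)"
    and ev_0: "ev 0 = 0" and ev_mono: "mono ev" and ev_top: "filterlim ev at_top sequentially"
begin

lemma \<nu>_L2: "\<nu> i \<in> L2 V"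
  using complete by (simp add: complete_orthonormal_def)

lemma \<nu>_orthonormal: "inner_V V (\<nu> i) (\<nu> j) = (if i = j then 1 else 0)"
  using complete by (simp add: complete_orthonormal_def)

lemma ev_nonneg: "0 \<le> ev i"
  using ev_mono ev_0 by (metis monoD le0)

lemma laplacian_\<nu>: "laplacian_rel W V (\<nu> i) (laplacian W V (\<nu> i))"
  using domain[of i] someI_ex[of "laplacian_rel W V (\<nu> i)"]
  by (simp add: laplacian_domain_def laplacian_def)

text \<open>
  Symmetry of the Laplacian, tested against an eigenvector.
\<close>

lemma inner_smooth_laplacian:
  assumes "lateral_smooth W V f G g"
  shows "inner_V V g (\<nu> i) = - ev i * inner_V V f (\<nu> i)"
proof -
  have rel: "laplacian_rel W V f g" using assms by (rule lateral_smooth_laplacian)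
  then have f: "f \<in> L2 V" by (simp add: laplacian_rel_def)
  have l: "laplacian W V (\<nu> i) \<in> borel_measurable borel"
    using laplacian_\<nu>[of i] by (auto simp: laplacian_rel_def L2_zero_mean_def L2_def)
  have "inner_V V g (\<nu> i) = inner_V V (laplacian W V (\<nu> i)) f"
    using laplacian_symmetric[OF rel laplacian_\<nu>[of i]] by (simp add: inner_V_commute)
  also have "\<dots> = inner_V V (\<lambda>x. - ev i * \<nu> i x) f"
    using eigen[of i] L2_D(1)[OF f] L2_D(1)[OF \<nu>_L2[of i]]
    by (intro inner_V_cong l) (auto simp: AE_torus_def elim!: eventually_mono)
  also have "\<dots> = - ev i * inner_V V f (\<nu> i)"
    by (simp only: inner_V_cmult inner_V_commute[of V f])
  finally show ?thesis .
qed

lemma energy_form_sums: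
  assumes s: "lateral_smooth W V f G g"
  shows "(\<lambda>i. (1 + ev i) * (inner_V V f (\<nu> i))\<^sup>2) sums inner_V V (\<lambda>x. f x - g x) f"
proof -
  have f: "f \<in> L2 V" and g: "g \<in> L2 V"
    using lateral_smooth_laplacian[OF s] by (auto simp: laplacian_rel_def L2_zero_mean_def)
  have "(\<lambda>i. inner_V V (\<lambda>x. f x - g x) (\<nu> i) * inner_V V f (\<nu> i)) sums inner_V V (\<lambda>x. f x - g x) f"
    by (rule Parseval[OF complete L2_diff[OF f g] f])
  moreover have "inner_V V (\<lambda>x. f x - g x) (\<nu> i) * inner_V V f (\<nu> i) = (1 + ev i) * (inner_V V f (\<nu> i))\<^sup>2" for i
    using inner_smooth_laplacian[OF s, of i] inner_V_diff[OF f g \<nu>_L2, of i]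
    by (simp add: algebra_simps power2_eq_square)
  ultimately show ?thesis by simp
qed

text \<open>
  The second part shows that the square root in \<open>energy_norm\<close> has a nonnegative argument, without which
  its square would not be the energy form.
\<close>

lemma energy_Parseval:
  assumes "f \<in> smooth_WV W V"
  shows "(\<lambda>i. (1 + ev i) * (inner_V V f (\<nu> i))\<^sup>2) sums (energy_norm W V f)\<^sup>2"
    and "0 \<le> energy_norm W V f"
proof -
  obtain G g where s: "lateral_smooth W V f G g" using assms smooth_WV_iff by blast
  have "0 \<le> inner_V V (\<lambda>x. f x - g x) f"
    using ev_nonneg by (intro sums_le[OF _ sums_zero energy_form_sums[OF s]]) (simp add: add_nonneg_nonneg)
  then show "(\<lambda>i. (1 + ev i) * (inner_V V f (\<nu> i))\<^sup>2) sums (energy_norm W V f)\<^sup>2"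
    "0 \<le> energy_norm W V f"
    using energy_form_sums[OF s] by (simp_all add: energy_norm_def lateral_smooth_derivs[OF s])
qed

lemma energy_partial_sum_le:
  assumes "f \<in> smooth_WV W V"
  shows "(\<Sum>i<K. ev i * (inner_V V f (\<nu> i))\<^sup>2) \<le> (energy_norm W V f)\<^sup>2"
proof -
  have "(\<Sum>i<K. ev i * (inner_V V f (\<nu> i))\<^sup>2) \<le> (\<Sum>i<K. (1 + ev i) * (inner_V V f (\<nu> i))\<^sup>2)"
    by (intro sum_mono mult_right_mono) auto
  also have "\<dots> \<le> (energy_norm W V f)\<^sup>2"
    using energy_Parseval(1)[OF assms] ev_nonneg
    by (subst sums_unique[OF energy_Parseval(1)[OF assms]], intro sum_le_suminf) (auto simp: sums_iff add_nonneg_nonneg)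
  finally show ?thesis .
qed

lemma smooth_diff:
  assumes "f \<in> smooth_WV W V" "g \<in> smooth_WV W V"
  shows "(\<lambda>x. f x - g x) \<in> smooth_WV W V"
proof -
  obtain F f' G g' where "lateral_smooth W V f F f'" "lateral_smooth W V g G g'"
    using assms smooth_WV_iff by meson
  from lateral_smooth_add[OF this(1) lateral_smooth_cmult[OF this(2), of "- 1"]]
  show ?thesis unfolding smooth_WV_iff by (auto intro!: exI)
qed

lemma smooth_L2: "f \<in> smooth_WV W V \<Longrightarrow> f \<in> L2 V"
  by (rule cadlag_L2) (auto simp: smooth_WV_def)

section \<open>Spectral description of the Sobolev space\<close>

text \<open>
  Fix \<open>F N\<close> beyond which all energy distances are below 1.  In a partial sum of length \<open>K\<close> the limit
  \<open>m \<longlonglongrightarrow> \<infinity>\<close> may be taken term by term, so the coefficients of \<open>f\<close> differ from those of \<open>F N\<close> by at most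
  1 in the weighted norm, uniformly in \<open>K\<close>.
\<close>

lemma H_space_imp_summable:
  assumes "f \<in> H_space W V"
  shows "summable (\<lambda>i. ev i * (inner_V V f (\<nu> i))\<^sup>2)"
proof -
  obtain F where f: "f \<in> L2 V" and F: "\<And>n. F n \<in> smooth_WV W V"
    and lim: "L2_converges V F f" and cau: "energy_Cauchy W V F"
    using assms by (auto simp: H_space_def)
  obtain N where N: "\<And>m n. m \<ge> N \<Longrightarrow> n \<ge> N \<Longrightarrow> energy_norm W V (\<lambda>x. F m x - F n x) < 1"
    using cau unfolding energy_Cauchy_def by (metis zero_less_one)
  define c where "c n i = inner_V V (F n) (\<nu> i)" for n i
  define \<alpha> where "\<alpha> i = inner_V V f (\<nu> i)" for i
  have c_lim: "(\<lambda>n. c n i) \<longlonglongrightarrow> \<alpha> i" for i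
    unfolding c_def \<alpha>_def by (intro L2_converges_inner smooth_L2 F f \<nu>_L2 lim)
  have near: "(\<Sum>i<K. ev i * (\<alpha> i - c N i)\<^sup>2) \<le> 1" for K
  proof (rule tendsto_upperbound)
    show "(\<lambda>m. \<Sum>i<K. ev i * (c m i - c N i)\<^sup>2) \<longlonglongrightarrow> (\<Sum>i<K. ev i * (\<alpha> i - c N i)\<^sup>2)"
      by (intro tendsto_intros c_lim)
    show "\<forall>\<^sub>F m in sequentially. (\<Sum>i<K. ev i * (c m i - c N i)\<^sup>2) \<le> 1"
      unfolding eventually_sequentially
    proof (intro exI allI impI)
      fix m assume "N \<le> m"
      let ?d = "\<lambda>x. F m x - F N x"
      have "(\<Sum>i<K. ev i * (c m i - c N i)\<^sup>2) \<le> (energy_norm W V ?d)\<^sup>2"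
        using energy_partial_sum_le[OF smooth_diff[OF F[of m] F[of N]], of K]
        by (simp add: inner_V_diff smooth_L2 F \<nu>_L2 c_def)
      also have "\<dots> \<le> 1\<^sup>2"
      proof (rule power_mono)
        show "energy_norm W V ?d \<le> 1" using N[OF \<open>N \<le> m\<close>] by (simp add: less_imp_le)
        show "0 \<le> energy_norm W V ?d" by (rule energy_Parseval(2)[OF smooth_diff[OF F F]])
      qed
      finally show "(\<Sum>i<K. ev i * (c m i - c N i)\<^sup>2) \<le> 1" by simp
    qed
  qed simp
  show ?thesis
    unfolding \<alpha>_def[symmetric]
  proof (rule summableI_nonneg_bounded)
    show "0 \<le> ev i * (\<alpha> i)\<^sup>2" for i using ev_nonneg by simp
    fix K
    \<comment> \<open>This is \<open>x\<^sup>2 \<le> 2 (x - y)\<^sup>2 + 2 y\<^sup>2\<close>, equivalent to \<open>0 \<le> (x - 2 y)\<^sup>2\<close>.\<close>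
    have "ev i * (\<alpha> i)\<^sup>2 \<le> 2 * (ev i * (\<alpha> i - c N i)\<^sup>2) + 2 * (ev i * (c N i)\<^sup>2)" for i
    proof -
      have "0 \<le> (\<alpha> i - 2 * c N i)\<^sup>2" by simp
      then have "(\<alpha> i)\<^sup>2 \<le> 2 * (\<alpha> i - c N i)\<^sup>2 + 2 * (c N i)\<^sup>2"
        by (simp add: power2_eq_square algebra_simps)
      from mult_left_mono[OF this ev_nonneg[of i]] show ?thesis by (simp add: algebra_simps)
    qed
    then have "(\<Sum>i<K. ev i * (\<alpha> i)\<^sup>2) \<le> (\<Sum>i<K. 2 * (ev i * (\<alpha> i - c N i)\<^sup>2) + 2 * (ev i * (c N i)\<^sup>2))"
      by (rule sum_mono)
    also have "\<dots> = 2 * (\<Sum>i<K. ev i * (\<alpha> i - c N i)\<^sup>2) + 2 * (\<Sum>i<K. ev i * (c N i)\<^sup>2)"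
      by (simp add: sum.distrib sum_distrib_left)
    also have "\<dots> \<le> 2 * 1 + 2 * (energy_norm W V (F N))\<^sup>2"
      using near[of K] energy_partial_sum_le[OF F[of N], of K] by (simp add: c_def)
    finally show "(\<Sum>i<K. ev i * (\<alpha> i)\<^sup>2) \<le> 2 * 1 + 2 * (energy_norm W V (F N))\<^sup>2" .
  qed
qed

text \<open>
  The theorem writes the first term of the series as a number, so the constant value \<open>c\<close> of \<open>\<nu> 0\<close> is
  absorbed into the coefficient.
\<close>

lemma Fourier_series_ground_constant:
  assumes f: "f \<in> L2 V" and c: "AE_torus V (\<lambda>x. \<nu> 0 x = c)"
  shows "L2_converges V (\<lambda>n x. inner_V V f (\<nu> 0) * c + (\<Sum>i=1..n. inner_V V f (\<nu> i) * \<nu> i x)) f"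
proof (rule L2_converges_cong)
  let ?S = "\<lambda>n x. \<Sum>i<Suc n. inner_V V f (\<nu> i) * \<nu> i x"
  have [measurable]: "\<nu> i \<in> borel_measurable borel" for i using L2_D(1)[OF \<nu>_L2] .
  have "L2_converges V (\<lambda>n x. \<Sum>i<n. inner_V V f (\<nu> i) * \<nu> i x) f"
    using complete f by (simp add: complete_orthonormal_def)
  then show "L2_converges V ?S f"
    unfolding L2_converges_def by (rule LIMSEQ_Suc)
  show "?S n \<in> borel_measurable borel" for n by measurable
  show "(\<lambda>x. inner_V V f (\<nu> 0) * c + (\<Sum>i=1..n. inner_V V f (\<nu> i) * \<nu> i x)) \<in> borel_measurable borel" for n
    by measurable
  show "f \<in> borel_measurable borel" using L2_D(1)[OF f] .
  show "AE_torus V (\<lambda>x. ?S n x = inner_V V f (\<nu> 0) * c + (\<Sum>i=1..n. inner_V V f (\<nu> i) * \<nu> i x))" for n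
  proof -
    have "{..<Suc n} = insert 0 {1..n}" by auto
    then have "?S n x = inner_V V f (\<nu> 0) * \<nu> 0 x + (\<Sum>i=1..n. inner_V V f (\<nu> i) * \<nu> i x)" for x
      by simp
    then show ?thesis using c unfolding AE_torus_def by (auto elim!: eventually_mono)
  qed
qed

lemma smooth_combination:
  fixes e :: "nat \<Rightarrow> real \<Rightarrow> real"
  assumes "\<And>i. e i \<in> smooth_WV W V"
  shows "(\<lambda>x. a + (\<Sum>i=1..n. \<alpha> i * e i x)) \<in> smooth_WV W V"
proof (induction n)
  case 0
  then show ?case using lateral_smooth_const[of W V a] unfolding smooth_WV_iff by auto
next
  case (Suc n)
  obtain F f' where 1: "lateral_smooth W V (\<lambda>x. a + (\<Sum>i=1..n. \<alpha> i * e i x)) F f'"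
    using Suc smooth_WV_iff by blast
  obtain G g' where 2: "lateral_smooth W V (e (Suc n)) G g'"
    using assms smooth_WV_iff by blast
  from lateral_smooth_add[OF 1 lateral_smooth_cmult[OF 2, of "\<alpha> (Suc n)"]]
  show ?case unfolding smooth_WV_iff by (auto simp: add.assoc intro!: exI)
qed

text \<open>
  With smooth representatives \<open>e i\<close> of the eigenvectors, the partial sums \<open>F n\<close> are smooth, and
  \<open>F m - F n\<close> has coefficients \<open>\<alpha> j\<close> for \<open>n < j \<le> m\<close> and 0 otherwise.  Its energy is therefore a block
  of the series of \<open>(1 + ev j) * (\<alpha> j)\<^sup>2\<close>; the number \<open>\<alpha> 0\<close> cancels in the difference.
\<close>

lemma series_imp_H_space:
  assumes f: "f \<in> L2 V"
    and lim: "L2_converges V (\<lambda>n x. \<alpha> 0 + (\<Sum>i=1..n. \<alpha> i * \<nu> i x)) f"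
    and summ: "summable (\<lambda>i. ev (Suc i) * (\<alpha> (Suc i))\<^sup>2)"
  shows "f \<in> H_space W V"
proof -
  have "\<forall>i. \<exists>e. e \<in> smooth_WV W V \<and> AE_torus V (\<lambda>x. e x = \<nu> i x)"
    using eigenfunction_smooth_representative[OF laplacian_\<nu> eigen] by blast
  then obtain e where e: "\<And>i. e i \<in> smooth_WV W V" and e\<nu>: "\<And>i. AE_torus V (\<lambda>x. e i x = \<nu> i x)"
    by metis
  have all: "AE x in dV V. \<forall>i. x \<in> {0..<1} \<longrightarrow> e i x = \<nu> i x"
    unfolding AE_all_countable using e\<nu> unfolding AE_torus_def by blast
  have [measurable]: "\<nu> i \<in> borel_measurable borel" "e i \<in> borel_measurable borel" for i
    using L2_D(1)[OF \<nu>_L2] L2_D(1)[OF smooth_L2[OF e]] by auto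
  define F where "F n x = \<alpha> 0 + (\<Sum>i=1..n. \<alpha> i * e i x)" for n x
  have F: "F n \<in> smooth_WV W V" for n
    unfolding F_def[abs_def] by (rule smooth_combination[OF e])
  have "L2_converges V F f"
  proof (rule L2_converges_cong[OF _ _ _ _ lim])
    show "(\<lambda>x. \<alpha> 0 + (\<Sum>i=1..n. \<alpha> i * \<nu> i x)) \<in> borel_measurable borel" for n by measurable
    show "F n \<in> borel_measurable borel" for n using L2_D(1)[OF smooth_L2[OF F]] .
    show "f \<in> borel_measurable borel" using L2_D(1)[OF f] .
    show "AE_torus V (\<lambda>x. \<alpha> 0 + (\<Sum>i=1..n. \<alpha> i * \<nu> i x) = F n x)" for n
      using all unfolding AE_torus_def by eventually_elim (simp add: F_def)
  qed
  moreover have "energy_Cauchy W V F"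
  proof -
    define t where "t i = (1 + ev i) * (\<alpha> i)\<^sup>2" for i
    have t_nonneg: "0 \<le> t i" for i using ev_nonneg[of i] by (simp add: t_def)
    \<comment> \<open>From some index on \<open>1 \<le> ev i\<close>, hence \<open>1 + ev i \<le> 2 * ev i\<close>.\<close>
    have "summable (\<lambda>i. t (Suc i))"
    proof (rule summable_comparison_test_ev)
      show "summable (\<lambda>i. 2 * (ev (Suc i) * (\<alpha> (Suc i))\<^sup>2))" using summ by (rule summable_mult)
      have "\<forall>\<^sub>F i in sequentially. 1 \<le> ev (Suc i)"
        using ev_top unfolding filterlim_at_top by (intro eventually_sequentially_Suc[THEN iffD2]) blast
      then show "\<forall>\<^sub>F i in sequentially. norm (t (Suc i)) \<le> 2 * (ev (Suc i) * (\<alpha> (Suc i))\<^sup>2)"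
      proof eventually_elim
        case (elim i)
        have "(1 + ev (Suc i)) * (\<alpha> (Suc i))\<^sup>2 \<le> (2 * ev (Suc i)) * (\<alpha> (Suc i))\<^sup>2"
          using elim by (intro mult_right_mono) auto
        then show ?case using t_nonneg[of "Suc i"] by (simp add: t_def)
      qed
    qed
    then have t_sum: "summable t" by (simp add: summable_Suc_iff)
    have coeff: "inner_V V (\<lambda>x. F m x - F n x) (\<nu> j) = (if j \<in> {n<..m} then \<alpha> j else 0)" if "n \<le> m" for m n j
    proof -
      have "{1..m} = {1..n} \<union> {n<..m}" "{1..n} \<inter> {n<..m} = {}" using that by auto
      then have diff: "F m x - F n x = (\<Sum>i\<in>{n<..m}. \<alpha> i * e i x)" for x
        by (simp add: F_def sum.union_disjoint)
      have "inner_V V (\<lambda>x. F m x - F n x) (\<nu> j) = inner_V V (\<lambda>x. \<Sum>i\<in>{n<..m}. \<alpha> i * \<nu> i x) (\<nu> j)"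
        unfolding diff
      proof (rule inner_V_cong)
        show "AE_torus V (\<lambda>x. (\<Sum>i\<in>{n<..m}. \<alpha> i * e i x) = (\<Sum>i\<in>{n<..m}. \<alpha> i * \<nu> i x))"
          using all unfolding AE_torus_def by eventually_elim simp
      qed measurable
      also have "\<dots> = (\<Sum>i\<in>{n<..m}. \<alpha> i * inner_V V (\<nu> i) (\<nu> j))"
        by (subst inner_V_sum) (auto simp: inner_V_cmult intro!: L2_cmult \<nu>_L2)
      also have "\<dots> = (if j \<in> {n<..m} then \<alpha> j else 0)"
        by (simp add: \<nu>_orthonormal if_distrib[of "\<lambda>z. _ * z"] sum.delta cong: if_cong)
      finally show ?thesis .
    qed
    have energy: "(energy_norm W V (\<lambda>x. F m x - F n x))\<^sup>2 = sum t {n<..m}" if "n \<le> m" for m n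
    proof (rule sums_unique2)
      show "(\<lambda>i. (1 + ev i) * (inner_V V (\<lambda>x. F m x - F n x) (\<nu> i))\<^sup>2) sums (energy_norm W V (\<lambda>x. F m x - F n x))\<^sup>2"
        by (rule energy_Parseval(1)[OF smooth_diff[OF F F]])
      show "(\<lambda>i. (1 + ev i) * (inner_V V (\<lambda>x. F m x - F n x) (\<nu> i))\<^sup>2) sums sum t {n<..m}"
        using sums_If_finite_set[of "{n<..m}" t]
        by (simp add: coeff[OF that] t_def if_distrib[of "\<lambda>z. _ * z\<^sup>2"] cong: if_cong)
    qed
    have sym: "(energy_norm W V (\<lambda>x. F m x - F n x))\<^sup>2 = (energy_norm W V (\<lambda>x. F n x - F m x))\<^sup>2" for m n
    proof (rule sums_unique2)
      show "(\<lambda>i. (1 + ev i) * (inner_V V (\<lambda>x. F m x - F n x) (\<nu> i))\<^sup>2) sums (energy_norm W V (\<lambda>x. F m x - F n x))\<^sup>2"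
        by (rule energy_Parseval(1)[OF smooth_diff[OF F F]])
      have "(inner_V V (\<lambda>x. F n x - F m x) (\<nu> i))\<^sup>2 = (inner_V V (\<lambda>x. F m x - F n x) (\<nu> i))\<^sup>2" for i
        by (simp add: inner_V_diff smooth_L2 F \<nu>_L2 power2_commute)
      then show "(\<lambda>i. (1 + ev i) * (inner_V V (\<lambda>x. F m x - F n x) (\<nu> i))\<^sup>2) sums (energy_norm W V (\<lambda>x. F n x - F m x))\<^sup>2"
        using energy_Parseval(1)[OF smooth_diff[OF F F], of n m] by simp
    qed
    show ?thesis
      unfolding energy_Cauchy_def
    proof (intro allI impI)
      fix \<epsilon> :: real assume "\<epsilon> > 0"
      then obtain N where N: "\<And>m n. m \<ge> N \<Longrightarrow> norm (sum t {m..<n}) < \<epsilon>\<^sup>2"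
        using t_sum unfolding summable_Cauchy by (meson zero_less_power)
      have ordered: "(energy_norm W V (\<lambda>x. F m x - F n x))\<^sup>2 < \<epsilon>\<^sup>2" if "N \<le> n" "n \<le> m" for m n
      proof -
        have "{n<..m} = {Suc n..<Suc m}" by auto
        then show ?thesis using N[of "Suc n" "Suc m"] that by (simp add: energy)
      qed
      have "energy_norm W V (\<lambda>x. F m x - F n x) < \<epsilon>" if "N \<le> m" "N \<le> n" for m n
      proof (rule power_less_imp_less_base)
        show "(energy_norm W V (\<lambda>x. F m x - F n x))\<^sup>2 < \<epsilon>\<^sup>2"
          using ordered[of n m] ordered[of m n] sym[of m n] that by (cases "n \<le> m") auto
      qed (use \<open>\<epsilon> > 0\<close> in simp)
      then show "\<exists>N. \<forall>m\<ge>N. \<forall>n\<ge>N. energy_norm W V (\<lambda>x. F m x - F n x) < \<epsilon>" by blast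
    qed
  qed
  ultimately show ?thesis using f F by (auto simp: H_space_def)
qed

end

theorem theorem9:
  fixes W V :: "real \<Rightarrow> real"
    and \<nu> :: "nat \<Rightarrow> real \<Rightarrow> real"
    and ev :: "nat \<Rightarrow> real"
  assumes "strict_mono W" and "cadlag W"
    and "\<And>x. W (x + 1) - W x = W 1 - W 0"
    and "isCont W 0" and "W 0 = 0"
    and "strict_mono V" and "caglad V"
    and "\<And>x. V (x + 1) - V x = V 1 - V 0"
    and "isCont V 0" and "V 0 = 0"
    and "complete_orthonormal V \<nu>"
    and "\<And>i. \<nu> i \<in> laplacian_domain W V"
    and "\<And>i. AE_torus V (\<lambda>x. - laplacian W V (\<nu> i) x = ev i * \<nu> i x)"
    and "ev 0 = 0" and "mono ev" and "filterlim ev at_top sequentially"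
    and "\<exists>c. AE_torus V (\<lambda>x. \<nu> 0 x = c)"
  shows "H_space W V =
    {f \<in> L2 V. \<exists>\<alpha> :: nat \<Rightarrow> real.
        L2_converges V (\<lambda>n x. \<alpha> 0 + (\<Sum>i=1..n. \<alpha> i * \<nu> i x)) f \<and>
        summable (\<lambda>i. ev (Suc i) * (\<alpha> (Suc i))\<^sup>2)}"
proof -
  interpret torus_spectrum W V \<nu> ev
    by unfold_locales (fact assms)+
  show ?thesis
  proof (intro equalityI subsetI)
    fix f assume H: "f \<in> H_space W V"
    then have f: "f \<in> L2 V" by (simp add: H_space_def)
    obtain c where c: "AE_torus V (\<lambda>x. \<nu> 0 x = c)" using assms(17) by blast
    define \<alpha> where "\<alpha> i = (if i = 0 then inner_V V f (\<nu> 0) * c else inner_V V f (\<nu> i))" for i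
    have "L2_converges V (\<lambda>n x. \<alpha> 0 + (\<Sum>i=1..n. \<alpha> i * \<nu> i x)) f"
      using Fourier_series_ground_constant[OF f c] by (simp add: \<alpha>_def)
    moreover have "summable (\<lambda>i. ev (Suc i) * (\<alpha> (Suc i))\<^sup>2)"
      using H_space_imp_summable[OF H] by (subst (asm) summable_Suc_iff[symmetric]) (simp add: \<alpha>_def)
    ultimately show "f \<in> {f \<in> L2 V. \<exists>\<alpha> :: nat \<Rightarrow> real.
        L2_converges V (\<lambda>n x. \<alpha> 0 + (\<Sum>i=1..n. \<alpha> i * \<nu> i x)) f \<and>
        summable (\<lambda>i. ev (Suc i) * (\<alpha> (Suc i))\<^sup>2)}"
      using f by blast
  qed (use series_imp_H_space in blast)
qed

end
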